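(* Assume that $q\ge 3$ (a prime power) and $r=\ell=2$. Fix a regular spread $\mathcal{S}$ of $\mathrm{PG}(3,q)$. Then the following are equivalent: (1) $\min\{2q+2,\,3q-3\}\le n\le q^2+1$. (2) There exists an $(n,n-2,2)$ MDS array code $\mathcal{C}$ over $\mathbb{F}_q$ whose induced node lines all lie in $\mathcal{S}$, and such that at least one (and hence all) of $\beta_{\mathrm{avg}}(\mathcal{C})$, $\beta_{\max}(\mathcal{C})$, $\gamma_{\mathrm{avg}}(\mathcal{C})$, $\gamma_{\max}(\mathcal{C})$ attains the projective counting bound, i.e. is equal to $2(n-1)-(q+1)$.
   Context: Codes. Write $[n]=\{1,\dots,n\}$. An $(n,k,\ell)$ linear array code over $\mathbb{F}_q$ is an $\mathbb{F}_q$-subspace $\mathcal{C}\le(\mathbb{F}_q^\ell)^n$ of dimension $k\ell$; here $n,k,\ell$ are positive integers with $1\le k<n$, and $r:=n-k$. It is described by a block parity-check matrix $H=[H_1\ \cdots\ H_n]\in\mathbb{F}_q^{r\ell\times n\ell}$ of full row rank $r\ell$, with $H_i\in\mathbb{F}_q^{r\ell\times\ell}$, so that $\mathcal{C}=\{(C_1,\dots,C_n)\in(\mathbb{F}_q^\ell)^n:\sum_{i=1}^n H_iC_i=0\}$. The code is MDS if for every $I\subseteq[n]$ with $|I|=r$ the square matrix $[H_i]_{i\in I}$ is invertible. For $i\in[n]$ let $\mathcal{M}_i=\{M\in\mathbb{F}_q^{\ell\times r\ell}: MH_i\text{ is invertible}\}$. For $M\in\mathcal{M}_i$ put $\mathrm{BW}_i(M)=\sum_{j\ne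 i}\mathrm{rank}(MH_j)$ (repair bandwidth) and $\mathrm{IO}_i(M)=\sum_{j\ne i}\mathrm{nz}(MH_j)$ (repair I/O), where $\mathrm{nz}(A)$ is the number of nonzero columns of $A$. Define $\beta_i(\mathcal{C})=\min_{M\in\mathcal{M}_i}\mathrm{BW}_i(M)$, $\gamma_i(\mathcal{C})=\min_{M\in\mathcal{M}_i}\mathrm{IO}_i(M)$, $\beta_{\mathrm{avg}}(\mathcal{C})=\frac1n\sum_{i=1}^n\beta_i(\mathcal{C})$, $\beta_{\max}(\mathcal{C})=\max_i\beta_i(\mathcal{C})$, $\gamma_{\mathrm{avg}}(\mathcal{C})=\frac1n\sum_{i=1}^n\gamma_i(\mathcal{C})$, $\gamma_{\max}(\mathcal{C})=\max_i\gamma_i(\mathcal{C})$. Projective counting bound. For every $(n,k,\ell)$ MDS array code over $\mathbb{F}_q$ with $r=n-k\ge 2$, each of $\beta_{\mathrm{avg}},\beta_{\max},\gamma_{\mathrm{avg}},\gamma_{\max}$ is at least $\ell(n-1)-\frac{q^{(r-1)\ell}-1}{q-1}$; for $r=\ell=2$ this lower bound equals $2(n-1)-(q+1)$. Node lines. When $r=\ell=2$, the parity-check blocks $H_i\in\mathbb{F}_q^{4\times 2}$ of an $(n,n-2,2)$ MDS array code have rank $2$; the column space $\mathcal{H}_i\le\mathbb{F}_q^4$ of $H_i$ is $2$-dimensional, and its projectivization $\mathbb{P}(\mathcal{H}_i)$ is a line of $\mathrm{PG}(3,q)$, the $i$-th induced node line of the code (given by $H$). Spreads. A spread of $\mathrm{PG}(3,q)$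 is a set of lines partitioning the points of $\mathrm{PG}(3,q)$. A transversal of a set $\mathcal{L}$ of lines is a line meeting every line of $\mathcal{L}$. A regulus is a nonempty set $\mathcal{R}$ of pairwise skew lines in $\mathrm{PG}(3,q)$ such that through each point of each line of $\mathcal{R}$ there passes a transversal of $\mathcal{R}$, and through each point of a transversal of $\mathcal{R}$ there passes a line of $\mathcal{R}$. Any three pairwise skew lines $L_1,L_2,L_3$ lie in a unique regulus $\mathcal{R}(L_1,L_2,L_3)$. A spread $\mathcal{S}$ is regular if $\mathcal{R}(L_1,L_2,L_3)\subseteq\mathcal{S}$ for every three distinct lines $L_1,L_2,L_3\in\mathcal{S}$.
   Formalization: "At least one (and hence all)" is proved at the level of existence: (1) is equivalent to (2) with "at least one" and to (2) with "all". That each code attaining one attains all is not claimed; it is false, since gamma depends on the bases of the node spaces (q=5, n=12). *)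

theory Defs
  imports "HOL-Analysis.Analysis" "HOL-Library.Disjoint_Sets"
begin

text \<open>
  Array codes over the finite field \<^typ>\<open>'a\<close>. The length \<open>n\<close> is \<open>CARD('n)\<close>, the sub-packetization \<open>\<ell>\<close> is
  \<open>CARD('l)\<close>, and \<open>(F\<^sup>\<ell>)\<^sup>n\<close> is represented as \<open>F\<^sup>n\<^sup>\<ell>\<close> with coordinates indexed by
  \<open>'n \<times> 'l\<close>, so that the library's linear algebra on \<open>'a ^ _\<close> applies. The rows of a
  parity-check matrix are indexed by \<open>'m\<close>, where \<open>CARD('m) = r\<ell>\<close>.
\<close>

definition word_block :: "'a::field ^ ('n::finite \<times> 'l::finite) \<Rightarrow> 'n \<Rightarrow> 'a ^ 'l" where
  "word_block c i = (\<chi> b. c $ (i, b))"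

definition mat_block :: "'a::field ^ ('n::finite \<times> 'l::finite) ^ 'm \<Rightarrow> 'n \<Rightarrow> 'a ^ 'l ^ 'm" where
  "mat_block H i = (\<chi> a b. H $ a $ (i, b))"

definition array_code :: "nat \<Rightarrow> ('a::field ^ ('n::finite \<times> 'l::finite)) set \<Rightarrow> bool" where
  "array_code k C \<longleftrightarrow>
     1 \<le> k \<and> k < CARD('n) \<and> vec.subspace C \<and> vec.dim C = k * CARD('l)"

text \<open>
  Together with \<open>array_code k C\<close>, full row rank forces \<open>CARD('m) = (n - k)\<ell>\<close>.
\<close>

definition parity_check_matrix ::
    "('a::field ^ ('n::finite \<times> 'l::finite)) set \<Rightarrow> 'a ^ ('n \<times> 'l) ^ 'm \<Rightarrow> bool" where
  "parity_check_matrix C H \<longleftrightarrow>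
     rank H = CARD('m) \<and>
     C = {c. (\<Sum>i\<in>UNIV. mat_block H i *v word_block c i) = 0}"

text \<open>
  The square matrix formed by the blocks \<open>H\<^sub>i\<close>, \<open>i \<in> I\<close>, is written by enumerating its columns,
  i.e. the index set \<open>I \<times> 'l\<close>, by \<open>e\<close>; the order of the columns does not affect invertibility.
  Such an \<open>e\<close> exists whenever \<open>CARD('m) = (n - k)\<ell>\<close>.
\<close>

definition mds :: "nat \<Rightarrow> 'a::field ^ ('n::finite \<times> 'l::finite) ^ 'm \<Rightarrow> bool" where
  "mds k H \<longleftrightarrow>
     (\<forall>I e. card I = CARD('n) - k \<and> bij_betw e (UNIV :: 'm set) (I \<times> (UNIV :: 'l set))
        \<longrightarrow> invertible ((\<chi> a b. H $ a $ e b) :: 'a ^ 'm ^ 'm))"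

definition repair_matrices :: "'a::field ^ ('n::finite \<times> 'l::finite) ^ 'm \<Rightarrow> 'n \<Rightarrow> ('a ^ 'm ^ 'l) set" where
  "repair_matrices H i = {M. invertible (M ** mat_block H i)}"

definition nz :: "'a::field ^ 'l ^ 'k \<Rightarrow> nat" where
  "nz A = card {b. column b A \<noteq> 0}"

definition repair_bandwidth ::
    "'a::field ^ ('n::finite \<times> 'l::finite) ^ 'm \<Rightarrow> 'n \<Rightarrow> 'a ^ 'm ^ 'l \<Rightarrow> nat" where
  "repair_bandwidth H i M = (\<Sum>j\<in>UNIV - {i}. rank (M ** mat_block H j))"

definition repair_io ::
    "'a::field ^ ('n::finite \<times> 'l::finite) ^ 'm \<Rightarrow> 'n \<Rightarrow> 'a ^ 'm ^ 'l \<Rightarrow> nat" where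
  "repair_io H i M = (\<Sum>j\<in>UNIV - {i}. nz (M ** mat_block H j))"

text \<open>
  The quantities below depend only on the code: two full-rank parity-check matrices of one code
  differ by an invertible left factor, which is absorbed by the repair matrices.
\<close>

definition beta :: "'a::{field,finite} ^ ('n::finite \<times> 'l::finite) ^ 'm \<Rightarrow> 'n \<Rightarrow> nat" where
  "beta H i = Min (repair_bandwidth H i ` repair_matrices H i)"

definition gamma :: "'a::{field,finite} ^ ('n::finite \<times> 'l::finite) ^ 'm \<Rightarrow> 'n \<Rightarrow> nat" where
  "gamma H i = Min (repair_io H i ` repair_matrices H i)"

definition beta_avg :: "'a::{field,finite} ^ ('n::finite \<times> 'l::finite) ^ 'm \<Rightarrow> real" where
  "beta_avg H = (\<Sum>i\<in>UNIV. real (beta H i)) / real CARD('n)"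

definition beta_max :: "'a::{field,finite} ^ ('n::finite \<times> 'l::finite) ^ 'm \<Rightarrow> real" where
  "beta_max H = real (Max (range (beta H)))"

definition gamma_avg :: "'a::{field,finite} ^ ('n::finite \<times> 'l::finite) ^ 'm \<Rightarrow> real" where
  "gamma_avg H = (\<Sum>i\<in>UNIV. real (gamma H i)) / real CARD('n)"

definition gamma_max :: "'a::{field,finite} ^ ('n::finite \<times> 'l::finite) ^ 'm \<Rightarrow> real" where
  "gamma_max H = real (Max (range (gamma H)))"

text \<open>
  Projective geometry of \<open>'a ^ 'm\<close>, i.e. \<open>PG(3,q)\<close> for \<open>'m = 4\<close>: a point is a one-dimensional
  subspace, and a line is the set of points of a two-dimensional subspace.
\<close>

definition pg_points :: "('a::field ^ 'm) set set" where
  "pg_points = {P. vec.subspace P \<and> vec.dim P = 1}"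

definition projectivization :: "('a::field ^ 'm) set \<Rightarrow> ('a ^ 'm) set set" where
  "projectivization U = {P \<in> pg_points. P \<subseteq> U}"

definition pg_lines :: "('a::field ^ 'm) set set set" where
  "pg_lines = projectivization ` {U. vec.subspace U \<and> vec.dim U = 2}"

definition node_line :: "'a::field ^ ('n::finite \<times> 'l::finite) ^ 'm \<Rightarrow> 'n \<Rightarrow> ('a ^ 'm) set set" where
  "node_line H i = projectivization (vec.span (columns (mat_block H i)))"

definition spread :: "('a::field ^ 4) set set set \<Rightarrow> bool" where
  "spread S \<longleftrightarrow> S \<subseteq> pg_lines \<and> partition_on pg_points S"

definition transversal :: "('a::field ^ 4) set set set \<Rightarrow> ('a ^ 4) set set \<Rightarrow> bool" where
  "transversal \<L> T \<longleftrightarrow> T \<in> pg_lines \<and> (\<forall>L\<in>\<L>. T \<inter> L \<noteq> {})"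

definition regulus :: "('a::field ^ 4) set set set \<Rightarrow> bool" where
  "regulus R \<longleftrightarrow>
     R \<noteq> {} \<and> R \<subseteq> pg_lines \<and> pairwise disjnt R \<and>
     (\<forall>L\<in>R. \<forall>P\<in>L. \<exists>T. transversal R T \<and> P \<in> T) \<and>
     (\<forall>T. transversal R T \<longrightarrow> (\<forall>P\<in>T. \<exists>L\<in>R. P \<in> L))"

text \<open>
  Only meaningful for pairwise skew lines, which lie in a unique regulus.
\<close>

definition regulus_through ::
    "('a::field ^ 4) set set \<Rightarrow> ('a ^ 4) set set \<Rightarrow> ('a ^ 4) set set \<Rightarrow> ('a ^ 4) set set set" where
  "regulus_through L1 L2 L3 = (THE R. regulus R \<and> {L1, L2, L3} \<subseteq> R)"

definition regular_spread :: "('a::field ^ 4) set set set \<Rightarrow> bool" where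
  "regular_spread S \<longleftrightarrow>
     spread S \<and>
     (\<forall>L1\<in>S. \<forall>L2\<in>S. \<forall>L3\<in>S. L1 \<noteq> L2 \<and> L1 \<noteq> L3 \<and> L2 \<noteq> L3
        \<longrightarrow> regulus_through L1 L2 L3 \<subseteq> S)"

end

theory Submission imports Defs begin

text \<open>
  A repair matrix for node \<open>i\<close> is determined up to a left factor by its kernel \<open>K\<close>, a line skew to
  the \<open>i\<close>-th node line, and it saves one symbol on every other node line that \<open>K\<close> meets. Hence
  \<open>\<beta>\<^sub>i\<close> attains the bound iff all \<open>q + 1\<close> points of some such \<open>K\<close>, itself not a node line, lie on
  node lines. The lines of a regular spread and the reguli contained in it are the points and circles
  of an inversive plane of order \<open>q\<close>, and the spread lines met by \<open>K\<close> form a circle. So the bound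
  is attained iff the circles contained in the set of node lines have no common point. Two disjoint
  circles have \<open>2q + 2\<close> points; otherwise three circles without a common point are needed, which meet
  pairwise in at most two points and have at least \<open>3q - 3\<close> points. For the repair I/O, the columns of
  \<open>H\<^sub>i\<close> are chosen on the transversals used; two columns suffice since each node line is on at most two
  of the chosen circles.
\<close>

subsection \<open>Finite inversive planes\<close>

text \<open>A kernel for node \<open>i\<close> must be skew to line \<open>i\<close>, so a circle
  that certifies optimality for \<open>i\<close> has to omit \<open>i\<close>, while one circle can
  serve every node off it; this is why only common points of the circles matter. The bound holds at
  each single node, so an average or a maximum equal to it forces equality everywhere. As beta is at
  most gamma, necessity can be argued for beta alone and sufficiency for gamma alone. The constant
  3q - 3 is 3(q + 1) minus two points for each of three pairs of circles; for q \<ge> 3 it is below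
  2q + 2 exactly when q is 3 or 4. Regularity of the spread enters through the uniqueness of the
  circle through three lines: such a circle must be the regulus of the three lines. The other
  incidence data comes from counting vectors, so the combinatorial part is phrased for a 3-(q^2 + 1,
  q + 1, 1) design.\<close>

locale inversive_plane =
  fixes X :: "'p set" and Circ :: "'p set set" and q :: nat
  assumes finite_points: "finite X"
    and card_points: "card X = q\<^sup>2 + 1"
    and circle_subset: "B \<in> Circ \<Longrightarrow> B \<subseteq> X"
    and card_circle: "B \<in> Circ \<Longrightarrow> card B = q + 1"
    and circle_exists:
      "\<lbrakk>x \<in> X; y \<in> X; z \<in> X; x \<noteq> y; x \<noteq> z; y \<noteq> z\<rbrakk> \<Longrightarrow> \<exists>B\<in>Circ. x \<in> B \<and> y \<in> B \<and> z \<in> B"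
    and circle_unique:
      "\<lbrakk>B \<in> Circ; B' \<in> Circ; {x, y, z} \<subseteq> B; {x, y, z} \<subseteq> B'; x \<noteq> y; x \<noteq> z; y \<noteq> z\<rbrakk> \<Longrightarrow> B = B'"
    and order_ge_3: "q \<ge> 3"
begin

lemma finite_circle: "B \<in> Circ \<Longrightarrow> finite B"
  using circle_subset finite_points finite_subset by blast

lemma card_Int_circles:
  assumes "B \<in> Circ" "B' \<in> Circ" "B \<noteq> B'"
  shows "card (B \<inter> B') \<le> 2"
proof (rule ccontr)
  assume "\<not> ?thesis"
  then obtain T where T: "T \<subseteq> B \<inter> B'" "card T = 3"
    by (metis not_less_eq_eq numeral_2_eq_2 numeral_3_eq_3 obtain_subset_with_card_n)
  then obtain x y z where "T = {x, y, z}" "x \<noteq> y" "x \<noteq> z" "y \<noteq> z"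
    by (auto simp: card_3_iff)
  with T circle_unique[OF assms(1,2), of x y z] assms(3) show False by auto
qed

text \<open>A third point determines the circle, so the members of the pencil split the other q^2 -
  1 = (q + 1)(q - 1) points into classes of size q - 1.\<close>

lemma card_pencil:
  assumes "x \<in> X" "y \<in> X" "x \<noteq> y"
  shows "card {B \<in> Circ. x \<in> B \<and> y \<in> B} = q + 1"
proof -
  let ?P = "{B \<in> Circ. x \<in> B \<and> y \<in> B}"
  have fin: "finite ?P"
    by (rule finite_subset[of _ "Pow X"]) (use circle_subset finite_points in auto)
  have "(\<Union>B\<in>?P. B - {x, y}) = X - {x, y}"
  proof
    show "X - {x, y} \<subseteq> (\<Union>B\<in>?P. B - {x, y})"
    proof
      fix z assume z: "z \<in> X - {x, y}"
      then obtain B where "B \<in> Circ" "x \<in> B" "y \<in> B" "z \<in> B"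
        using circle_exists[of x y z] assms by auto
      with z show "z \<in> (\<Union>B\<in>?P. B - {x, y})" by auto
    qed
  qed (use circle_subset in auto)
  moreover have "card (\<Union>B\<in>?P. B - {x, y}) = (\<Sum>B\<in>?P. card (B - {x, y}))"
  proof (rule card_UN_disjoint)
    show "\<forall>B\<in>?P. \<forall>B'\<in>?P. B \<noteq> B' \<longrightarrow> (B - {x, y}) \<inter> (B' - {x, y}) = {}"
    proof (intro ballI impI)
      fix B B' assume B: "B \<in> ?P" "B' \<in> ?P" "B \<noteq> B'"
      have "z = x \<or> z = y" if "z \<in> B" "z \<in> B'" for z
        using circle_unique[of B B' x y z] B that assms(3) by auto
      then show "(B - {x, y}) \<inter> (B' - {x, y}) = {}" by auto
    qed
  qed (use fin finite_circle in auto)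
  moreover have "(\<Sum>B\<in>?P. card (B - {x, y})) = (\<Sum>B\<in>?P. q - 1)"
    using assms(3) by (intro sum.cong refl) (auto simp: card_circle card_Diff_subset)
  moreover have "card (X - {x, y}) = q\<^sup>2 - 1"
    using assms by (simp add: card_Diff_subset card_points)
  ultimately have "card ?P * (q - 1) = q\<^sup>2 - 1" by simp
  also have "\<dots> = (q + 1) * (q - 1)"
    by (simp add: power2_eq_square algebra_simps)
  finally show ?thesis using order_ge_3 by (subst (asm) mult_cancel2) simp
qed

lemma obtain_circle_and_point:
  obtains C x where "C \<in> Circ" "x \<in> X" "x \<notin> C"
proof -
  have "q * 3 \<le> q\<^sup>2"
    using order_ge_3 by (simp add: power2_eq_square)
  then have "3 \<le> card X" and less: "q + 1 < card X"
    using card_points order_ge_3 by auto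
  then obtain T where "T \<subseteq> X" "card T = 3"
    by (meson obtain_subset_with_card_n)
  then obtain a b c where "{a, b, c} \<subseteq> X" "a \<noteq> b" "a \<noteq> c" "b \<noteq> c"
    by (auto simp: card_3_iff)
  then obtain C where C: "C \<in> Circ" using circle_exists[of a b c] by auto
  then have "C \<noteq> X" using less card_circle by auto
  with C that circle_subset show thesis by blast
qed

text \<open>
  In a pencil through two points off a circle \<open>C\<close> that has a member meeting \<open>C\<close> twice,
  at most \<open>q\<close> of the \<open>q + 1\<close> members meet \<open>C\<close>.
\<close>

lemma disjoint_circles:
  obtains B B' where "B \<in> Circ" "B' \<in> Circ" "B \<inter> B' = {}"
proof -
  obtain C x where C: "C \<in> Circ" and x: "x \<in> X" "x \<notin> C"
    by (rule obtain_circle_and_point)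
  have "2 \<le> card C" using C card_circle order_ge_3 by simp
  then obtain T where "T \<subseteq> C" "card T = 2"
    by (meson obtain_subset_with_card_n)
  then obtain c c' where c: "c \<in> C" "c' \<in> C" "c \<noteq> c'" by (auto simp: card_2_iff)
  then obtain D where D: "D \<in> Circ" "x \<in> D" "c \<in> D" "c' \<in> D"
    using circle_exists[of x c c'] x C circle_subset by blast
  \<comment> \<open>Since q + 1 \<ge> 4, there is a fourth point \<open>y\<close> on
    \<open>D\<close>. The pencil through \<open>x\<close> and \<open>y\<close> then contains
    \<open>D\<close>, which meets \<open>C\<close> in both \<open>c\<close> and
    \<open>c'\<close>.\<close>
  have "card {x, c, c'} \<le> 3" by (simp add: card_insert_if)
  then have "\<not> D \<subseteq> {x, c, c'}"
    using card_circle[OF D(1)] order_ge_3 card_mono[of "{x, c, c'}" D] by auto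
  then obtain y where y: "y \<in> D" "y \<noteq> x" "y \<noteq> c" "y \<noteq> c'" by blast
  then have yC: "y \<notin> C"
    using circle_unique[of C D c c' y] C D c x by auto
  let ?P = "{B \<in> Circ. x \<in> B \<and> y \<in> B}"
  have fin: "finite ?P"
    by (rule finite_subset[of _ "Pow X"]) (use circle_subset finite_points in auto)
  have "\<forall>z\<in>C. \<exists>B. B \<in> ?P \<and> z \<in> B"
    using circle_exists[of x y] x y yC C D circle_subset by (smt (verit) mem_Collect_eq subsetD)
  then obtain g where g: "\<And>z. z \<in> C \<Longrightarrow> g z \<in> ?P \<and> z \<in> g z" by metis
  have uniq: "B = g z" if "B \<in> ?P" "z \<in> C" "z \<in> B" for B z
    using circle_unique[of B "g z" x y z] that g x y yC by blast
  have "g c = g c'" using uniq[of D c] uniq[of D c'] c D y by simp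
  then have "g ` C = g ` (C - {c'})" using c by auto
  then have "card (g ` C) \<le> q"
    by (metis C add_diff_cancel_right' c(2) card_Diff_singleton card_circle card_image_le
        finite_Diff finite_circle)
  then have "\<not> ?P \<subseteq> g ` C"
    using card_pencil[of x y] x y D circle_subset C finite_circle card_mono[of "g ` C" ?P]
    by fastforce
  then obtain B where "B \<in> ?P" "B \<notin> g ` C" by blast
  then have "B \<inter> C = {}" using uniq by blast
  with \<open>B \<in> ?P\<close> C that show thesis by blast
qed

text \<open>
  The circles through a fixed point \<open>x\<close> off \<open>C\<close> and two points of \<open>C\<close> have too many further
  points for all of them to be distinct, so two of them meet again off \<open>C\<close>.
\<close>

lemma three_circles:
  obtains A B C where "A \<in> Circ" "B \<in> Circ" "C \<in> Circ" "A \<inter> B \<inter> C = {}"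
    "card (A \<union> B \<union> C) \<le> 3 * q - 3"
proof -
  obtain C x where C: "C \<in> Circ" and x: "x \<in> X" "x \<notin> C"
    by (rule obtain_circle_and_point)
  note finC = finite_circle[OF C]
  let ?P = "{p. p \<subseteq> C \<and> card p = 2}"
  have "\<forall>p\<in>?P. \<exists>D. D \<in> Circ \<and> x \<in> D \<and> p \<subseteq> D"
  proof
    fix p assume p: "p \<in> ?P"
    then obtain a b where "p = {a, b}" "a \<noteq> b" by (auto simp: card_2_iff)
    then show "\<exists>D. D \<in> Circ \<and> x \<in> D \<and> p \<subseteq> D"
      using circle_exists[of x a b] p x C circle_subset by blast
  qed
  then obtain D where D: "\<And>p. p \<in> ?P \<Longrightarrow> D p \<in> Circ \<and> x \<in> D p \<and> p \<subseteq> D p" by metis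
  \<comment> \<open>\<open>D p\<close> differs from \<open>C\<close> because it passes through
    \<open>x\<close>, so it shares no more than the two points of \<open>p\<close> with
    \<open>C\<close>.\<close>
  have DC: "D p \<inter> C = p" if "p \<in> ?P" for p
  proof (rule sym, rule card_seteq)
    have "D p \<noteq> C" using D[OF that] x by auto
    then show "card (D p \<inter> C) \<le> card p"
      using card_Int_circles[of "D p" C] D[OF that] C that by simp
  qed (use D[OF that] that finC in auto)
  let ?E = "\<lambda>p. D p - (C \<union> {x})"
  have cardE: "card (?E p) = q - 2" if "p \<in> ?P" for p
  proof -
    have "?E p = D p - insert x p" using DC[OF that] by blast
    moreover have "x \<notin> p" "finite p" using that x finC by (auto intro: finite_subset)
    ultimately show ?thesis
      using D[OF that] that card_circle[of "D p"] by (simp add: card_Diff_subset)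
  qed
  have "\<exists>p\<in>?P. \<exists>p'\<in>?P. p \<noteq> p' \<and> ?E p \<inter> ?E p' \<noteq> {}"
  proof (rule ccontr)
    assume "\<not> ?thesis"
    then have "card (\<Union>p\<in>?P. ?E p) = (\<Sum>p\<in>?P. card (?E p))"
      using finC D by (intro card_UN_disjoint) (auto intro!: finite_circle)
    also have "\<dots> = (\<Sum>p\<in>?P. q - 2)" using cardE by (intro sum.cong refl)
    also have "\<dots> = (q + 1 choose 2) * (q - 2)"
      using n_subsets[OF finC, of 2] card_circle[OF C] by simp
    finally have "(q + 1 choose 2) * (q - 2) = card (\<Union>p\<in>?P. ?E p)" ..
    also have "\<dots> \<le> card (X - insert x C)"
      using D circle_subset finite_points by (intro card_mono) auto
    also have "\<dots> = q\<^sup>2 + 1 - (q + 2)"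
      using C x circle_subset finC card_circle[OF C] by (subst card_Diff_subset) (auto simp: card_points)
    finally have le: "(q + 1 choose 2) * (q - 2) \<le> q\<^sup>2 + 1 - (q + 2)" .
    \<comment> \<open>Writing q as \<open>t + 3\<close> removes the truncated subtractions and
      leaves a cubic bounded by a quadratic in \<open>t\<close>. The tightest case is q = 3, where 6
      points would have to fit into 5.\<close>
    obtain t where t: "q = t + 3" using order_ge_3 by (metis add.commute le_Suc_ex)
    have "2 * (q + 1 choose 2) = (q + 1) * q"
      by (simp add: choose_two)
    then have "(q + 1) * q * (q - 2) = 2 * ((q + 1 choose 2) * (q - 2))" by simp
    also have "\<dots> \<le> 2 * (q\<^sup>2 + 1 - (q + 2))" using le by (rule mult_le_mono2)
    finally have "(t + 4) * (t + 3) * (t + 1) \<le> 2 * ((t + 3)\<^sup>2 + 1 - (t + 5))"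
      by (simp add: t add.assoc add.commute)
    then have "(t + 4) * (t + 3) * (t + 1) \<le> 2 * (t * t + 5 * t + 5)"
      by (simp add: power2_eq_square algebra_simps)
    then show False by (simp add: algebra_simps)
  qed
  then obtain p p' y where p: "p \<in> ?P" "p' \<in> ?P" "p \<noteq> p'" and y: "y \<in> ?E p" "y \<in> ?E p'" by blast
  have ne: "D p \<noteq> D p'" using DC p by metis
  \<comment> \<open>A common point of \<open>p\<close> and \<open>p'\<close> would be a third point,
    besides \<open>x\<close> and \<open>y\<close>, shared by two distinct circles.\<close>
  have disj: "p \<inter> p' = {}"
  proof (rule ccontr)
    assume "p \<inter> p' \<noteq> {}"
    then obtain i where "i \<in> p" "i \<in> p'" by blast
    then show False
      using circle_unique[of "D p" "D p'" x y i] D[OF p(1)] D[OF p(2)] p y x ne by blast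
  qed
  have "{x, y} = D p \<inter> D p'"
    using D p y card_Int_circles[of "D p" "D p'"] ne finite_circle x
    by (intro card_seteq) auto
  then have int: "card (D p \<inter> D p') = 2" using y by (metis DiffE Un_iff card_2_iff insertCI)
  have "card (D p \<union> D p') = 2 * q"
    using card_Un_Int[of "D p" "D p'"] D p card_circle finite_circle int by simp
  moreover have "(D p \<union> D p') \<inter> C = p \<union> p'" using DC p by blast
  moreover have "card (p \<union> p') = 4"
    using p disj finC by (subst card_Un_disjoint) (auto intro: finite_subset)
  \<comment> \<open>The pairwise intersections \<open>{x, y}\<close>, \<open>p\<close> and
    \<open>p'\<close> are disjoint and have two points each, which leaves exactly 3(q + 1) - 6
    points.\<close>
  ultimately have "card (D p \<union> D p' \<union> C) + 4 = 2 * q + (q + 1)"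
    using card_Un_Int[of "D p \<union> D p'" C] D p C card_circle finite_circle by simp
  moreover have "D p \<inter> D p' \<inter> C = {}"
    using DC[OF p(1)] DC[OF p(2)] disj by blast
  ultimately show thesis using that[of "D p" "D p'" C] D p C by simp
qed

text \<open>Take a circle \<open>A\<close> and a circle \<open>B\<close> missing a point of
  \<open>A\<close>. If they share a point \<open>y\<close>, a third circle \<open>C\<close> missing
  \<open>y\<close> differs from both. The three may still have a common point, but \<open>C\<close>
  meets the union of \<open>A\<close> and \<open>B\<close> in at most 2 + 2 points, so the union of
  all three has at least 2q + (q + 1) - 4 points.\<close>

lemma card_ge_if_no_common_point:
  assumes "N \<subseteq> X" "N \<noteq> {}" and avoid: "\<And>x. x \<in> N \<Longrightarrow> \<exists>B\<in>Circ. B \<subseteq> N \<and> x \<notin> B"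
  shows "min (2 * q + 2) (3 * q - 3) \<le> card N"
proof -
  have finN: "finite N" using assms(1) finite_points finite_subset by blast
  obtain A where A: "A \<in> Circ" "A \<subseteq> N" using assms(2) avoid by blast
  then obtain x where x: "x \<in> A" using card_circle[of A] by fastforce
  then obtain B where B: "B \<in> Circ" "B \<subseteq> N" "x \<notin> B" using avoid A by blast
  have AB: "card (A \<union> B) + card (A \<inter> B) = 2 * q + 2"
    using card_Un_Int[of A B] A B card_circle finite_circle by simp
  show ?thesis
  proof (cases "A \<inter> B = {}")
    case True
    then have "2 * q + 2 = card (A \<union> B)" using AB by simp
    also have "\<dots> \<le> card N" using A B finN by (intro card_mono) auto
    finally show ?thesis by simp
  next
    case False
    then obtain y where y: "y \<in> A" "y \<in> B" by blast
    then obtain C where C: "C \<in> Circ" "C \<subseteq> N" "y \<notin> C" using avoid A by blast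
    have "card (A \<inter> B) \<le> 2" "card (A \<inter> C) \<le> 2" "card (B \<inter> C) \<le> 2"
      using A B C x y by (auto intro!: card_Int_circles)
    moreover have "card ((A \<union> B) \<inter> C) \<le> card (A \<inter> C) + card (B \<inter> C)"
      by (metis Int_Un_distrib2 card_Un_le)
    moreover have "card (A \<union> B \<union> C) + card ((A \<union> B) \<inter> C) = card (A \<union> B) + (q + 1)"
      using card_Un_Int[of "A \<union> B" C] A B C card_circle finite_circle by simp
    moreover have "card (A \<union> B \<union> C) \<le> card N" using A B C finN by (intro card_mono) auto
    ultimately show ?thesis using AB by linarith
  qed
qed

text \<open>The union of two or three suitable circles is padded with arbitrary points up to size
  \<open>n\<close>. No point is on more than two of the circles, because there are at most three of
  them and each point is missed by one.\<close>

lemma obtain_points_with_circles: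
  assumes "min (2 * q + 2) (3 * q - 3) \<le> n" "n \<le> q\<^sup>2 + 1"
  obtains N \<F> where "N \<subseteq> X" "card N = n" "\<F> \<subseteq> Circ" "\<Union>\<F> \<subseteq> N" "\<forall>x. \<exists>B\<in>\<F>. x \<notin> B"
    "\<forall>x. card {B \<in> \<F>. x \<in> B} \<le> 2"
proof -
  have "\<exists>\<F>\<subseteq>Circ. card (\<Union>\<F>) \<le> n \<and> (\<forall>x. \<exists>B\<in>\<F>. x \<notin> B) \<and> finite \<F> \<and> card \<F> \<le> 3"
  proof (cases "2 * q + 2 \<le> n")
    case True
    obtain B B' where B: "B \<in> Circ" "B' \<in> Circ" "B \<inter> B' = {}" by (rule disjoint_circles)
    have "card (B \<union> B') = 2 * q + 2"
      using B card_circle finite_circle by (simp add: card_Un_disjoint)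
    with True B show ?thesis
      by (intro exI[of _ "{B, B'}"]) (auto simp: card_insert_if)
  next
    case False
    obtain A B C where A: "A \<in> Circ" "B \<in> Circ" "C \<in> Circ" "A \<inter> B \<inter> C = {}"
      "card (A \<union> B \<union> C) \<le> 3 * q - 3"
      by (rule three_circles)
    then show ?thesis using False assms(1)
      by (intro exI[of _ "{A, B, C}"]) (auto simp: card_insert_if Un_assoc)
  qed
  then obtain \<F> where F: "\<F> \<subseteq> Circ" "card (\<Union>\<F>) \<le> n" "\<And>x. \<exists>B\<in>\<F>. x \<notin> B" "finite \<F>" "card \<F> \<le> 3"
    by blast
  have "\<Union>\<F> \<subseteq> X" using F(1) circle_subset by blast
  then obtain N where N: "\<Union>\<F> \<subseteq> N" "N \<subseteq> X" "card N = n"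
    using exists_subset_between[of "\<Union>\<F>" n X] F(2) assms(2) card_points finite_points by auto
  have "card {B \<in> \<F>. x \<in> B} \<le> 2" for x
  proof -
    have "{B \<in> \<F>. x \<in> B} \<subset> \<F>" using F(3)[of x] by blast
    then have "card {B \<in> \<F>. x \<in> B} < card \<F>" by (rule psubset_card_mono[OF F(4)])
    with F(5) show ?thesis by simp
  qed
  then show thesis using that[of N \<F>] N F(1,3) by simp
qed

end

subsection \<open>Linear algebra over a finite field\<close>

lemma card_span_independent:
  fixes B :: "('a::{field,finite} ^ 'n) set"
  assumes "finite B" "vec.independent B"
  shows "card (vec.span B) = CARD('a) ^ card B"
  using assms
proof (induction B)
  case (insert a B)
  then have a: "a \<notin> vec.span B" and B: "vec.independent B"
    by (auto simp: vec.independent_insert)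
  let ?f = "\<lambda>(k, x). k *s a + x"
  have "vec.span (insert a B) = ?f ` (UNIV \<times> vec.span B)"
  proof (rule set_eqI)
    fix x
    have "x \<in> vec.span (insert a B) \<longleftrightarrow> (\<exists>k. x - k *s a \<in> vec.span B)"
      by (simp add: vec.span_insert)
    also have "\<dots> \<longleftrightarrow> x \<in> ?f ` (UNIV \<times> vec.span B)"
      by (auto simp: image_iff) (metis add.commute diff_add_cancel, metis add_diff_cancel_left')
    finally show "x \<in> vec.span (insert a B) \<longleftrightarrow> x \<in> ?f ` (UNIV \<times> vec.span B)" .
  qed
  moreover have "inj_on ?f (UNIV \<times> vec.span B)"
  proof (rule inj_onI, clarify)
    fix k x k' x'
    assume x: "x \<in> vec.span B" "x' \<in> vec.span B" and eq: "k *s a + x = k' *s a + x'"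
    have "(k - k') *s a = x' - x" using eq by (simp add: vec.scale_left_diff_distrib algebra_simps)
    then have "(k - k') *s a \<in> vec.span B" using x vec.span_diff by metis
    moreover have "inverse c *s (c *s a) = a" if "c \<noteq> 0" for c
      using that by simp
    ultimately have "k - k' = 0" using a vec.span_scale by metis
    then have "k = k'" by simp
    with eq show "k = k' \<and> x = x'" by simp
  qed
  ultimately show ?case using insert.IH[OF B] insert.hyps
    by (simp add: card_image card_cartesian_product)
qed simp

lemma card_subspace:
  fixes U :: "('a::{field,finite} ^ 'n) set"
  assumes "vec.subspace U"
  shows "card U = CARD('a) ^ vec.dim U"
  using assms card_span_independent by (metis vec.basis_subspace_exists)

lemma card_field_ge_2: "2 \<le> CARD('a::{field,finite})"
proof -
  have "card {0, 1 :: 'a} \<le> CARD('a)" by (rule card_mono) auto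
  then show ?thesis by simp
qed

subsection \<open>Lines as two-dimensional subspaces\<close>

text \<open>Lines are handled as vector subspaces so that dimension arguments apply directly;
  \<open>projectivization\<close> is the dictionary to the point-set notions of spread, regulus and
  node line.\<close>

definition dim2 :: "('a::field ^ 'n) set set" where
  "dim2 = {U. vec.subspace U \<and> vec.dim U = 2}"

definition meets :: "('a::field ^ 'n) set \<Rightarrow> ('a ^ 'n) set \<Rightarrow> bool" where
  "meets U U' \<longleftrightarrow> (\<exists>v. v \<noteq> 0 \<and> v \<in> U \<and> v \<in> U')"

lemma meets_commute: "meets U U' \<longleftrightarrow> meets U' U"
  by (auto simp: meets_def)

lemma dim2_subspace: "U \<in> dim2 \<Longrightarrow> vec.subspace U"
  by (simp add: dim2_def)

lemma dim2_subset_eq: "\<lbrakk>U \<in> dim2; U' \<in> dim2; U \<subseteq> U'\<rbrakk> \<Longrightarrow> U = U'"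
  using vec.subspace_dim_equal[of U U'] by (simp add: dim2_def)

lemma dim2_nonzero:
  assumes "U \<in> dim2"
  obtains v where "v \<in> U" "v \<noteq> 0"
  using assms vec.dim_eq_0[of U] by (force simp: dim2_def)

lemma dim2_meets_self: "U \<in> dim2 \<Longrightarrow> meets U U"
  by (metis dim2_nonzero meets_def)

lemma not_meets_Int:
  "\<lbrakk>vec.subspace U; vec.subspace U'; \<not> meets U U'\<rbrakk> \<Longrightarrow> U \<inter> U' = {0}"
  by (auto simp: meets_def vec.subspace_0)

text \<open>Two skew lines are complementary: their sum has dimension 2 + 2 - 0 = 4.\<close>

lemma skew_sum:
  fixes U U' :: "('a::field ^ 4) set"
  assumes "U \<in> dim2" "U' \<in> dim2" "\<not> meets U U'"
  obtains x y where "x \<in> U" "y \<in> U'" "w = x + y"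
proof -
  let ?S = "{x + y |x y. x \<in> U \<and> y \<in> U'}"
  have sub: "vec.subspace U" "vec.subspace U'" using assms by (auto simp: dim2_def)
  have "U \<inter> U' = {0}" using not_meets_Int sub assms by auto
  then have "vec.dim ?S = 4"
    using vec.dim_sums_Int[OF sub] assms by (simp add: dim2_def)
  then have "vec.span ?S = UNIV"
    using vec.dim_eq_full[of ?S] by (simp add: vec.dimension_def card_cart_basis)
  moreover have "vec.subspace ?S" by (rule vec.subspace_sums[OF sub])
  ultimately have "w \<in> ?S" using vec.span_eq_iff[of ?S] by simp
  then show thesis using that by auto
qed

lemma dim2_spanI:
  assumes "x \<noteq> 0" "y \<notin> vec.span {x}"
  shows "vec.span {x, y} \<in> dim2"
proof -
  have "vec.dim {y, x} = 2" using assms by (simp add: vec.dim_insert)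
  then show ?thesis by (simp add: dim2_def insert_commute)
qed

lemma not_in_span_skew:
  assumes "vec.subspace U" "\<not> meets U U'" "x \<in> U" "y \<in> U'" "y \<noteq> 0"
  shows "y \<notin> vec.span {x}"
  using assms vec.span_minimal[of "{x}" U] by (auto simp: meets_def)

lemma dim2_eq_span:
  assumes "K \<in> dim2" "x \<in> K" "y \<in> K" "x \<noteq> 0" "y \<notin> vec.span {x}"
  shows "K = vec.span {x, y}"
  using assms dim2_spanI[of x y] vec.span_minimal[of "{x, y}" K]
  by (metis dim2_subset_eq dim2_subspace empty_subsetI insert_subset)

lemma in_span_pair: "v \<in> vec.span {x, y} \<longleftrightarrow> (\<exists>a b. v = a *s x + b *s y)"
  by (auto simp: vec.span_insert vec.span_singleton algebra_simps)

lemma dim2_obtain_basis: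
  assumes "U \<in> dim2" "x \<in> U" "x \<noteq> 0"
  obtains y where "y \<in> U" "y \<notin> vec.span {x}" "U = vec.span {x, y}"
proof -
  have "\<not> U \<subseteq> vec.span {x}"
    using assms vec.dim_mono[of U "{x}"] by (auto simp: dim2_def)
  then obtain y where "y \<in> U" "y \<notin> vec.span {x}" by blast
  with that dim2_eq_span assms show thesis by blast
qed

text \<open>A transversal through \<open>p\<close> is spanned by its points on \<open>U\<close> and
  \<open>U'\<close>. These are the two components of \<open>p\<close> in the direct sum of
  \<open>U\<close> and \<open>U'\<close>, up to scalars, so they depend on \<open>p\<close>
  alone.\<close>

lemma transversal_through_unique:
  assumes K: "K \<in> dim2" "meets K U" "meets K U'" "p \<in> K"
    and K': "K' \<in> dim2" "meets K' U" "meets K' U'" "p \<in> K'"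
    and U: "vec.subspace U" "vec.subspace U'" "\<not> meets U U'" "p \<notin> U" "p \<notin> U'"
  shows "K = K'"
proof -
  obtain a b where a: "a \<in> K" "a \<in> U" "a \<noteq> 0" and b: "b \<in> K" "b \<in> U'" "b \<noteq> 0"
    using K by (auto simp: meets_def)
  obtain a' b' where a': "a' \<in> K'" "a' \<in> U" "a' \<noteq> 0" and b': "b' \<in> K'" "b' \<in> U'" "b' \<noteq> 0"
    using K' by (auto simp: meets_def)
  have span: "K = vec.span {a, b}" "K' = vec.span {a', b'}"
    using dim2_eq_span not_in_span_skew[OF U(1,3)] K(1) K'(1) a b a' b' by blast+
  obtain s t where st: "p = s *s a + t *s b" using K(4) by (auto simp: span in_span_pair)
  obtain s' t' where st': "p = s' *s a' + t' *s b'" using K'(4) by (auto simp: span in_span_pair)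
  have "s *s a - s' *s a' = t' *s b' - t *s b"
    using st st' by (simp add: algebra_simps)
  moreover have "s *s a - s' *s a' \<in> U" "t' *s b' - t *s b \<in> U'"
    using U a a' b b' by (simp_all add: vec.subspace_diff vec.subspace_scale)
  ultimately have eq: "s *s a = s' *s a'" "t *s b = t' *s b'"
    using U(3) by (auto simp: meets_def)
  \<comment> \<open>Here it matters that \<open>p\<close> is on neither line: both components of
    \<open>p\<close> are nonzero and can be rescaled to \<open>a\<close> and
    \<open>b\<close>.\<close>
  have "s \<noteq> 0" "t \<noteq> 0" using st a b U by (auto simp: vec.subspace_scale)
  then have "a = inverse s *s (s' *s a')" "b = inverse t *s (t' *s b')"
    unfolding eq[symmetric] by simp_all
  then have "a \<in> K'" "b \<in> K'"
    using a' b' dim2_subspace[OF K'(1)] by (metis vec.subspace_scale)+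
  then have "K \<subseteq> K'"
    unfolding span(1) using dim2_subspace[OF K'(1)] by (intro vec.span_minimal) auto
  then show ?thesis using K(1) K'(1) dim2_subset_eq by blast
qed

lemma pg_points_iff: "P \<in> pg_points \<longleftrightarrow> (\<exists>v. v \<noteq> 0 \<and> P = vec.span {v})"
proof
  assume P: "P \<in> pg_points"
  then have P: "vec.subspace P" "vec.dim P = 1" by (auto simp: pg_points_def)
  obtain B where B: "vec.independent B" "vec.span B = P" "card B = 1"
    using vec.basis_subspace_exists[OF P(1)] P(2) by metis
  then obtain v where "B = {v}" by (auto simp: card_1_singleton_iff)
  with B show "\<exists>v. v \<noteq> 0 \<and> P = vec.span {v}" by (auto simp: vec.dependent_single)
next
  assume "\<exists>v. v \<noteq> 0 \<and> P = vec.span {v}"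
  then show "P \<in> pg_points" by (auto simp: pg_points_def)
qed

lemma span_singleton_in_projectivization:
  assumes "vec.subspace U" "v \<noteq> 0"
  shows "vec.span {v} \<in> projectivization U \<longleftrightarrow> v \<in> U"
  using assms pg_points_iff[of "vec.span {v}"] vec.span_superset[of "{v}"] vec.span_minimal[of "{v}" U]
  by (auto simp: projectivization_def)

lemma projectivization_eqI:
  assumes "vec.subspace U" "vec.subspace U'" "projectivization U = projectivization U'"
  shows "U = U'"
proof -
  have "v \<in> U \<longleftrightarrow> v \<in> U'" for v
    using assms span_singleton_in_projectivization[of U v] span_singleton_in_projectivization[of U' v]
    by (cases "v = 0") (auto simp: vec.subspace_0)
  then show ?thesis by blast
qed

lemma projectivization_Int:
  assumes "vec.subspace U" "vec.subspace U'"
  shows "projectivization U \<inter> projectivization U' \<noteq> {} \<longleftrightarrow> meets U U'"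
proof
  assume "projectivization U \<inter> projectivization U' \<noteq> {}"
  then obtain P where P: "P \<in> projectivization U" "P \<in> projectivization U'" by blast
  then obtain v where "v \<noteq> 0" "P = vec.span {v}"
    by (auto simp: projectivization_def pg_points_iff)
  then show "meets U U'"
    using P assms by (auto simp: meets_def span_singleton_in_projectivization)
next
  assume "meets U U'"
  then obtain v where "v \<noteq> 0" "v \<in> U" "v \<in> U'" by (auto simp: meets_def)
  then have "vec.span {v} \<in> projectivization U \<inter> projectivization U'"
    using assms by (simp add: span_singleton_in_projectivization)
  then show "projectivization U \<inter> projectivization U' \<noteq> {}" by blast
qed

lemma pg_lines_eq: "pg_lines = projectivization ` dim2"
  by (simp add: pg_lines_def dim2_def)

lemma ball_projectivization:
  assumes "vec.subspace U"
  shows "(\<forall>P\<in>projectivization U. Q P) \<longleftrightarrow> (\<forall>v\<in>U. v \<noteq> 0 \<longrightarrow> Q (vec.span {v}))"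
proof
  assume Q: "\<forall>v\<in>U. v \<noteq> 0 \<longrightarrow> Q (vec.span {v})"
  show "\<forall>P\<in>projectivization U. Q P"
  proof
    fix P assume P: "P \<in> projectivization U"
    then obtain v where v: "v \<noteq> 0" "P = vec.span {v}"
      by (auto simp: projectivization_def pg_points_iff)
    then have "v \<in> U" using P assms by (simp add: span_singleton_in_projectivization)
    with Q v show "Q P" by blast
  qed
qed (use assms in \<open>auto simp: span_singleton_in_projectivization\<close>)

subsection \<open>Reguli\<close>

text \<open>The conditions of \<open>regulus\<close> read in the vector space, with nonzero vectors
  for points; \<open>regulus_projectivization\<close> is the translation.\<close>

definition vregulus :: "('a::field ^ 4) set set \<Rightarrow> bool" where
  "vregulus \<R> \<longleftrightarrow>
     \<R> \<noteq> {} \<and> \<R> \<subseteq> dim2 \<and>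
     (\<forall>U\<in>\<R>. \<forall>U'\<in>\<R>. meets U U' \<longrightarrow> U = U') \<and>
     (\<forall>U\<in>\<R>. \<forall>v\<in>U. v \<noteq> 0 \<longrightarrow> (\<exists>T\<in>dim2. v \<in> T \<and> (\<forall>U'\<in>\<R>. meets T U'))) \<and>
     (\<forall>T\<in>dim2. (\<forall>U\<in>\<R>. meets T U) \<longrightarrow> (\<forall>v\<in>T. v \<noteq> 0 \<longrightarrow> (\<exists>U\<in>\<R>. v \<in> U)))"

lemma vregulus_dim2: "\<lbrakk>vregulus \<R>; U \<in> \<R>\<rbrakk> \<Longrightarrow> U \<in> dim2"
  unfolding vregulus_def by (elim conjE) (rule subsetD)

lemma vregulus_skew: "\<lbrakk>vregulus \<R>; U \<in> \<R>; U' \<in> \<R>; U \<noteq> U'\<rbrakk> \<Longrightarrow> \<not> meets U U'"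
  unfolding vregulus_def by (elim conjE) metis

lemma vregulus_transversal_through:
  assumes "vregulus \<R>" "U \<in> \<R>" "v \<in> U" "v \<noteq> 0"
  obtains T where "T \<in> dim2" "v \<in> T" "\<And>U'. U' \<in> \<R> \<Longrightarrow> meets T U'"
  using assms unfolding vregulus_def by (elim conjE) meson

lemma vregulus_cover:
  assumes "vregulus \<R>" "T \<in> dim2" "\<And>U. U \<in> \<R> \<Longrightarrow> meets T U" "v \<in> T" "v \<noteq> 0"
  obtains U where "U \<in> \<R>" "v \<in> U"
  using assms unfolding vregulus_def by (elim conjE) meson

lemma transversal_projectivization:
  assumes "\<R> \<subseteq> dim2"
  shows "transversal (projectivization ` \<R>) T \<longleftrightarrow>
    (\<exists>K\<in>dim2. T = projectivization K \<and> (\<forall>U\<in>\<R>. meets K U))"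
proof -
  have "(\<forall>U\<in>\<R>. projectivization K \<inter> projectivization U \<noteq> {}) \<longleftrightarrow> (\<forall>U\<in>\<R>. meets K U)"
    if "K \<in> dim2" for K
    using assms that by (intro ball_cong refl projectivization_Int) (auto simp: dim2_def)
  then show ?thesis
    unfolding transversal_def pg_lines_eq by auto
qed

lemma regulus_projectivization:
  assumes R: "\<R> \<subseteq> dim2"
  shows "regulus (projectivization ` \<R>) \<longleftrightarrow> vregulus \<R>"
proof -
  have sub: "vec.subspace U" if "U \<in> \<R>" for U using that R by (auto simp: dim2_def)
  have "pairwise disjnt (projectivization ` \<R>) \<longleftrightarrow> (\<forall>U\<in>\<R>. \<forall>U'\<in>\<R>. meets U U' \<longrightarrow> U = U')"
  proof -
    have "projectivization U = projectivization U' \<longleftrightarrow> U = U'"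
      and "projectivization U \<inter> projectivization U' = {} \<longleftrightarrow> \<not> meets U U'"
      if "U \<in> \<R>" "U' \<in> \<R>" for U U'
      using projectivization_Int[OF sub sub, OF that] projectivization_eqI[OF sub sub, OF that]
      by blast+
    then show ?thesis by (auto simp: pairwise_def disjnt_def)
  qed
  moreover have "(\<forall>L\<in>projectivization ` \<R>. \<forall>P\<in>L. \<exists>T. transversal (projectivization ` \<R>) T \<and> P \<in> T)
     \<longleftrightarrow> (\<forall>U\<in>\<R>. \<forall>v\<in>U. v \<noteq> 0 \<longrightarrow> (\<exists>T\<in>dim2. v \<in> T \<and> (\<forall>U'\<in>\<R>. meets T U')))"
  proof -
    have "(\<exists>T. transversal (projectivization ` \<R>) T \<and> vec.span {v} \<in> T) \<longleftrightarrow>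
          (\<exists>T\<in>dim2. v \<in> T \<and> (\<forall>U'\<in>\<R>. meets T U'))" if "v \<noteq> 0" for v
    proof -
      have "(\<exists>T. transversal (projectivization ` \<R>) T \<and> vec.span {v} \<in> T) \<longleftrightarrow>
            (\<exists>K\<in>dim2. vec.span {v} \<in> projectivization K \<and> (\<forall>U'\<in>\<R>. meets K U'))"
        unfolding transversal_projectivization[OF R] by blast
      with that show ?thesis
        by (auto simp: span_singleton_in_projectivization dim2_subspace)
    qed
    then show ?thesis
      by (auto simp: ball_projectivization[OF sub])
  qed
  moreover have "(\<forall>T. transversal (projectivization ` \<R>) T \<longrightarrow> (\<forall>P\<in>T. \<exists>L\<in>projectivization ` \<R>. P \<in> L))
     \<longleftrightarrow> (\<forall>T\<in>dim2. (\<forall>U\<in>\<R>. meets T U) \<longrightarrow> (\<forall>v\<in>T. v \<noteq> 0 \<longrightarrow> (\<exists>U\<in>\<R>. v \<in> U)))"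
  proof -
    have "(\<forall>P\<in>projectivization K. \<exists>L\<in>projectivization ` \<R>. P \<in> L) \<longleftrightarrow>
          (\<forall>v\<in>K. v \<noteq> 0 \<longrightarrow> (\<exists>U\<in>\<R>. v \<in> U))" if "K \<in> dim2" for K
      unfolding ball_projectivization[OF dim2_subspace[OF that]]
      using span_singleton_in_projectivization[OF sub] by auto
    moreover have "(\<forall>T. transversal (projectivization ` \<R>) T \<longrightarrow> Q T) \<longleftrightarrow>
        (\<forall>K\<in>dim2. (\<forall>U\<in>\<R>. meets K U) \<longrightarrow> Q (projectivization K))" for Q
      unfolding transversal_projectivization[OF R] by blast
    ultimately show ?thesis by simp
  qed
  ultimately show ?thesis
    using R unfolding regulus_def vregulus_def pg_lines_eq by (simp add: image_mono)
qed

text \<open>Through the point where \<open>K\<close> meets \<open>U1\<close> there is a transversal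
  of the whole regulus. It and \<open>K\<close> are both the unique line through that point meeting
  \<open>U2\<close> and \<open>U3\<close>.\<close>

lemma vregulus_transversal:
  assumes R: "vregulus \<R>" "U1 \<in> \<R>" "U2 \<in> \<R>" "U3 \<in> \<R>" and ne: "U1 \<noteq> U2" "U1 \<noteq> U3" "U2 \<noteq> U3"
    and K: "K \<in> dim2" "meets K U1" "meets K U2" "meets K U3" and "U \<in> \<R>"
  shows "meets K U"
proof -
  obtain p where p: "p \<noteq> 0" "p \<in> K" "p \<in> U1" using K by (auto simp: meets_def)
  then obtain T where T: "T \<in> dim2" "p \<in> T" "\<And>U'. U' \<in> \<R> \<Longrightarrow> meets T U'"
    using vregulus_transversal_through[OF R(1,2)] by metis
  have skew: "\<not> meets U1 U2" "\<not> meets U1 U3" "\<not> meets U2 U3" and "U2 \<in> dim2" "U3 \<in> dim2"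
    using vregulus_skew[OF R(1)] vregulus_dim2[OF R(1)] R(2-4) ne by simp_all
  then have "K = T"
    using T R K p by (intro transversal_through_unique[of K U2 U3 p T])
      (auto simp: meets_def dim2_def)
  with T assms show ?thesis by blast
qed

text \<open>
  For three pairwise skew lines \<open>U1\<close>, \<open>U2\<close>, \<open>U3\<close> of \<open>PG(3,q)\<close>, the line \<open>U3\<close> is the graph of an
  isomorphism \<open>\<phi>\<close> from \<open>U1\<close> to \<open>U2\<close>.
\<close>

locale regulus_frame =
  fixes U1 U2 U3 :: "('a::{field,finite} ^ 4) set" and \<phi> :: "'a ^ 4 \<Rightarrow> 'a ^ 4"
  assumes dim2: "U1 \<in> dim2" "U2 \<in> dim2" "U3 \<in> dim2"
    and skew: "\<not> meets U1 U2" "\<not> meets U1 U3" "\<not> meets U2 U3"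
    and \<phi>_in: "x \<in> U1 \<Longrightarrow> \<phi> x \<in> U2"
    and graph: "x \<in> U1 \<Longrightarrow> x + \<phi> x \<in> U3"
    and \<phi>_add: "\<lbrakk>x \<in> U1; y \<in> U1\<rbrakk> \<Longrightarrow> \<phi> (x + y) = \<phi> x + \<phi> y"
    and \<phi>_scale: "x \<in> U1 \<Longrightarrow> \<phi> (c *s x) = c *s \<phi> x"
    and \<phi>_nonzero: "\<lbrakk>x \<in> U1; x \<noteq> 0\<rbrakk> \<Longrightarrow> \<phi> x \<noteq> 0"

text \<open>The space is the direct sum of \<open>U2\<close> and \<open>U3\<close>, and
  \<open>\<phi> x\<close> is minus the \<open>U2\<close>-component of \<open>x\<close>. Uniqueness
  of the component gives linearity, and skewness of \<open>U1\<close> and \<open>U3\<close> gives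
  injectivity on \<open>U1\<close>.\<close>

lemma obtain_regulus_frame:
  fixes U1 U2 U3 :: "('a::{field,finite} ^ 4) set"
  assumes U: "U1 \<in> dim2" "U2 \<in> dim2" "U3 \<in> dim2"
    and skew: "\<not> meets U1 U2" "\<not> meets U1 U3" "\<not> meets U2 U3"
  obtains \<phi> where "regulus_frame U1 U2 U3 \<phi>"
proof -
  note sub = U[THEN dim2_subspace]
  have "\<exists>y. y \<in> U2 \<and> x + y \<in> U3" for x
  proof -
    obtain a b where "a \<in> U2" "b \<in> U3" "x = a + b"
      using skew_sum[OF U(2,3) skew(3), of x] by blast
    then show ?thesis using sub
      by (intro exI[of _ "- a"]) (auto simp: vec.subspace_neg)
  qed
  then obtain \<phi> where \<phi>: "\<And>x. \<phi> x \<in> U2" "\<And>x. x + \<phi> x \<in> U3" by metis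
  have uniq: "\<phi> x = y" if "y \<in> U2" "x + y \<in> U3" for x y
  proof -
    have "\<phi> x - y \<in> U2" using that \<phi> sub by (simp add: vec.subspace_diff)
    moreover have "(x + \<phi> x) - (x + y) \<in> U3" by (rule vec.subspace_diff[OF sub(3) \<phi>(2) that(2)])
    ultimately show ?thesis using skew(3) by (auto simp: meets_def)
  qed
  have "\<phi> (x + y) = \<phi> x + \<phi> y" for x y
  proof (rule uniq)
    have "(x + \<phi> x) + (y + \<phi> y) \<in> U3" by (rule vec.subspace_add[OF sub(3) \<phi>(2) \<phi>(2)])
    then show "x + y + (\<phi> x + \<phi> y) \<in> U3" by (simp add: algebra_simps)
  qed (use \<phi> sub in \<open>simp add: vec.subspace_add\<close>)
  moreover have "\<phi> (c *s x) = c *s \<phi> x" for c x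
  proof (rule uniq)
    have "c *s (x + \<phi> x) \<in> U3" by (rule vec.subspace_scale[OF sub(3) \<phi>(2)])
    then show "c *s x + c *s \<phi> x \<in> U3" by (simp add: vec.scale_right_distrib)
  qed (use \<phi> sub in \<open>simp add: vec.subspace_scale\<close>)
  moreover have "\<phi> x \<noteq> 0" if "x \<in> U1" "x \<noteq> 0" for x
    using \<phi>(2)[of x] skew that by (auto simp: meets_def)
  ultimately show thesis
    using that[of \<phi>] U skew \<phi> by (simp add: regulus_frame_def)
qed

context regulus_frame
begin

lemmas sub = dim2[THEN dim2_subspace]

lemma decomposition_unique:
  assumes "x \<in> U1" "y \<in> U1" "x' \<in> U1" "y' \<in> U1" "x + \<phi> y = x' + \<phi> y'"
  shows "x = x'" "y = y'"
proof -
  have "x - x' = \<phi> y' - \<phi> y" using assms(5) by (simp add: algebra_simps)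
  moreover have "x - x' \<in> U1" "\<phi> y' - \<phi> y \<in> U2"
    using assms sub \<phi>_in by (simp_all add: vec.subspace_diff)
  ultimately have eq: "x - x' = 0" "\<phi> y' - \<phi> y = 0"
    using skew(1) by (auto simp: meets_def)
  then show "x = x'" by simp
  have "\<phi> (y' - y) = \<phi> y' + \<phi> ((- 1) *s y)"
    using \<phi>_add[of y' "- y"] assms sub by (simp add: vec.subspace_neg)
  then have "\<phi> (y' - y) = 0" using eq \<phi>_scale[of y "- 1"] assms by simp
  then show "y = y'" using \<phi>_nonzero[of "y' - y"] assms sub by (auto simp: vec.subspace_diff)
qed

lemma coordinates:
  assumes "x \<in> U1" "y \<in> U1" "a *s x + b *s \<phi> x = c *s y + d *s \<phi> y"
  shows "a *s x = c *s y" "b *s x = d *s y"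
  using decomposition_unique[of "a *s x" "b *s x" "c *s y" "d *s y"] assms sub
  by (simp_all add: \<phi>_scale vec.subspace_scale)

text \<open>Identifying \<open>U2\<close> with \<open>U1\<close> by \<phi> turns the space into U1
  \<otimes> F^2. Then \<open>ruling a b\<close> is U1 \<otimes> (a, b) and \<open>crossing p\<close>
  is p \<otimes> F^2: the two families of lines on a hyperbolic quadric, whose points are the pure
  tensors.\<close>

definition ruling :: "'a \<Rightarrow> 'a \<Rightarrow> ('a ^ 4) set" where
  "ruling a b = (\<lambda>x. a *s x + b *s \<phi> x) ` U1"

definition crossing :: "'a ^ 4 \<Rightarrow> ('a ^ 4) set" where
  "crossing p = vec.span {p, \<phi> p}"

text \<open>The parametrization by \<open>U1\<close> is injective, so the ruling has q^2 vectors;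
  over a finite field this cardinality fixes the dimension.\<close>

lemma ruling_dim2:
  assumes "a \<noteq> 0 \<or> b \<noteq> 0"
  shows "ruling a b \<in> dim2"
proof -
  have "vec.subspace (ruling a b)"
    unfolding vec.subspace_def ruling_def
  proof (intro conjI ballI allI)
    show "0 \<in> (\<lambda>x. a *s x + b *s \<phi> x) ` U1"
      using sub \<phi>_scale[of 0 0] by (intro image_eqI[of _ _ 0]) (auto simp: vec.subspace_0)
  next
    fix v w assume "v \<in> (\<lambda>x. a *s x + b *s \<phi> x) ` U1" "w \<in> (\<lambda>x. a *s x + b *s \<phi> x) ` U1"
    then obtain x y where "x \<in> U1" "y \<in> U1" "v = a *s x + b *s \<phi> x" "w = a *s y + b *s \<phi> y" by blast
    then show "v + w \<in> (\<lambda>x. a *s x + b *s \<phi> x) ` U1"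
      using sub by (intro image_eqI[of _ _ "x + y"])
        (simp_all add: \<phi>_add vec.scale_right_distrib vec.subspace_add)
  next
    fix c v assume "v \<in> (\<lambda>x. a *s x + b *s \<phi> x) ` U1"
    then obtain x where "x \<in> U1" "v = a *s x + b *s \<phi> x" by blast
    then show "c *s v \<in> (\<lambda>x. a *s x + b *s \<phi> x) ` U1"
      using sub by (intro image_eqI[of _ _ "c *s x"])
        (simp_all add: \<phi>_scale vec.scale_right_distrib vec.subspace_scale mult.commute)
  qed
  moreover have "inj_on (\<lambda>x. a *s x + b *s \<phi> x) U1"
  proof (rule inj_onI)
    fix x y assume "x \<in> U1" "y \<in> U1" "a *s x + b *s \<phi> x = a *s y + b *s \<phi> y"
    then have "a *s x = a *s y" "b *s x = b *s y" using coordinates by blast+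
    with assms show "x = y" by auto
  qed
  then have "card (ruling a b) = card U1" unfolding ruling_def by (rule card_image)
  ultimately have "CARD('a) ^ vec.dim (ruling a b) = CARD('a) ^ 2"
    using card_subspace[of "ruling a b"] card_subspace[of U1] sub dim2 by (simp add: dim2_def)
  then have "vec.dim (ruling a b) = 2"
    using card_field_ge_2[where 'a='a] power_inject_exp[of "CARD('a)"] by auto
  with \<open>vec.subspace (ruling a b)\<close> show ?thesis by (simp add: dim2_def)
qed

lemma ruling_simps: "ruling 1 0 = U1" "ruling 0 1 = U2" "ruling 1 1 = U3"
proof -
  show "ruling 1 0 = U1" by (simp add: ruling_def)
  show "ruling 0 1 = U2"
    using dim2 ruling_dim2[of 0 1] \<phi>_in by (intro dim2_subset_eq) (auto simp: ruling_def)
  show "ruling 1 1 = U3"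
    using dim2 ruling_dim2[of 1 1] graph by (intro dim2_subset_eq) (auto simp: ruling_def)
qed

text \<open>A common nonzero vector is a pure tensor x \<otimes> (a, b) = y \<otimes> (c, d). Its
  factors are determined up to scalars, so (a, b) and (c, d) are proportional and define the same
  ruling.\<close>

lemma ruling_eq_if_meets:
  assumes "meets (ruling a b) (ruling c d)" "a \<noteq> 0 \<or> b \<noteq> 0" "c \<noteq> 0 \<or> d \<noteq> 0"
  shows "ruling a b = ruling c d"
proof -
  obtain x y where xy: "x \<in> U1" "y \<in> U1" "a *s x + b *s \<phi> x = c *s y + d *s \<phi> y"
      and nz: "a *s x + b *s \<phi> x \<noteq> 0"
    using assms(1) by (auto simp: meets_def ruling_def)
  then have eq: "a *s x = c *s y" "b *s x = d *s y" using coordinates by blast+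
  have "y \<noteq> 0" using nz xy \<phi>_scale[of 0 0] by auto
  obtain k where k: "x = k *s y"
  proof (cases "a = 0")
    case True
    then have "x = inverse b *s (b *s x)" using assms(2) by simp
    then show thesis using that eq by (metis vector_smult_assoc)
  next
    case False
    then have "x = inverse a *s (a *s x)" by simp
    then show thesis using that eq by (metis vector_smult_assoc)
  qed
  then have "c = a * k" "d = b * k" using eq \<open>y \<noteq> 0\<close> by auto
  then have "c *s z + d *s \<phi> z = a *s (k *s z) + b *s \<phi> (k *s z)" if "z \<in> U1" for z
    using that by (simp add: \<phi>_scale)
  then have "ruling c d \<subseteq> ruling a b"
    using vec.subspace_scale[OF sub(1)] unfolding ruling_def by blast
  then show ?thesis using dim2_subset_eq ruling_dim2 assms by metis
qed

lemma crossing_dim2: "\<lbrakk>p \<in> U1; p \<noteq> 0\<rbrakk> \<Longrightarrow> crossing p \<in> dim2"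
  unfolding crossing_def
  using not_in_span_skew[OF sub(1) skew(1)] \<phi>_in \<phi>_nonzero by (intro dim2_spanI) auto

lemma in_crossing: "v \<in> crossing p \<longleftrightarrow> (\<exists>a b. v = a *s p + b *s \<phi> p)"
  by (simp add: crossing_def in_span_pair)

lemma crossing_meets_ruling:
  assumes "p \<in> U1" "p \<noteq> 0" "a \<noteq> 0 \<or> b \<noteq> 0"
  shows "meets (crossing p) (ruling a b)"
proof -
  have "a *s p + b *s \<phi> p \<noteq> 0"
    using coordinates[of p 0 a b 0 0] assms sub by (auto simp: vec.subspace_0)
  then show ?thesis
    using assms unfolding meets_def ruling_def in_crossing by blast
qed

lemma crossing_meets:
  assumes "p \<in> U1" "p \<noteq> 0"
  shows "meets (crossing p) U1" "meets (crossing p) U2" "meets (crossing p) U3"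
  using crossing_meets_ruling[OF assms, of 1 0] crossing_meets_ruling[OF assms, of 0 1]
    crossing_meets_ruling[OF assms, of 1 1] by (simp_all add: ruling_simps)

lemma crossing_skew:
  assumes p: "p \<in> U1" "p' \<in> U1" "p \<noteq> 0" "p' \<notin> vec.span {p}"
  shows "\<not> meets (crossing p) (crossing p')"
proof
  assume "meets (crossing p) (crossing p')"
  then obtain a b c d where eq: "a *s p + b *s \<phi> p = c *s p' + d *s \<phi> p'"
    and nz: "c *s p' + d *s \<phi> p' \<noteq> 0"
    unfolding meets_def in_crossing by metis
  then have "c *s p' \<in> vec.span {p}" "d *s p' \<in> vec.span {p}"
    using coordinates[OF p(1,2) eq] by (metis rangeI vec.span_singleton)+
  moreover have "p' = inverse k *s (k *s p')" if "k \<noteq> 0" for k using that by simp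
  ultimately have "c = 0" "d = 0" using p(4) by (metis vec.span_scale)+
  with nz show False by simp
qed

text \<open>The crossings at \<open>x\<close>, \<open>y\<close> and \<open>x + y\<close> are used
  for independent \<open>x\<close> and \<open>y\<close> in \<open>U1\<close>; these three points of
  \<open>U1\<close> are distinct over every field. They provide three skew lines of the opposite
  regulus for the uniqueness argument.\<close>

lemma three_skew_crossings:
  obtains T1 T2 T3 where "{T1, T2, T3} \<subseteq> dim2"
    "\<not> meets T1 T2" "\<not> meets T1 T3" "\<not> meets T2 T3"
    "\<forall>T\<in>{T1, T2, T3}. meets T U1 \<and> meets T U2 \<and> meets T U3"
proof -
  obtain x where x: "x \<in> U1" "x \<noteq> 0" using dim2 dim2_nonzero by blast
  obtain y where y: "y \<in> U1" "y \<notin> vec.span {x}" using dim2_obtain_basis[OF dim2(1) x] by blast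
  have "y \<noteq> 0" using y vec.span_zero by metis
  have "x + y \<notin> vec.span {x}"
    using y vec.span_add_eq[of x "{x}" y] vec.span_base[of x "{x}"] by simp
  moreover have "x + y \<notin> vec.span {y}"
  proof
    assume "x + y \<in> vec.span {y}"
    then have "x \<in> vec.span {y}"
      using vec.span_add_eq2[of y "{y}" x] vec.span_base[of y "{y}"] by simp
    then obtain k where "x = k *s y" by (auto simp: vec.span_singleton)
    moreover from this x have "k \<noteq> 0" by auto
    ultimately have "y = inverse k *s x" by simp
    then show False using y by (metis rangeI vec.span_singleton)
  qed
  moreover have "x + y \<in> U1" "x + y \<noteq> 0"
    using x y sub calculation vec.span_zero by (metis vec.subspace_add)+
  ultimately show thesis
    using that[of "crossing x" "crossing y" "crossing (x + y)"] x y \<open>y \<noteq> 0\<close>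
    crossing_skew[of x y] crossing_skew[of x "x + y"] crossing_skew[of y "x + y"]
    by (simp add: crossing_dim2 crossing_meets)
qed

text \<open>The crossings are the transversals. A line meeting all rulings meets \<open>U1\<close>,
  \<open>U2\<close> and \<open>U3\<close>, so it is the crossing through its point \<open>p\<close>
  on \<open>U1\<close>; its point \<open>a *s p + b *s \<phi> p\<close> lies on
  \<open>ruling a b\<close>.\<close>

lemma vregulus_rulings: "vregulus {ruling a b | a b. a \<noteq> 0 \<or> b \<noteq> 0}" (is "vregulus ?R")
  unfolding vregulus_def
proof (intro conjI ballI impI)
  show "?R \<noteq> {}" by (auto intro: exI[of _ 1])
  show "?R \<subseteq> dim2" using ruling_dim2 by blast
next
  fix U U' assume "U \<in> ?R" "U' \<in> ?R" "meets U U'"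
  then show "U = U'" using ruling_eq_if_meets by blast
next
  fix U v assume U: "U \<in> ?R" "v \<in> U" "v \<noteq> 0"
  then obtain a b x where x: "x \<in> U1" "v = a *s x + b *s \<phi> x" by (auto simp: ruling_def)
  then have "x \<noteq> 0" using U \<phi>_scale[of 0 0] by auto
  have "v \<in> crossing x" using x in_crossing by blast
  moreover have "\<forall>U'\<in>?R. meets (crossing x) U'"
    using crossing_meets_ruling[OF \<open>x \<in> U1\<close> \<open>x \<noteq> 0\<close>] by blast
  ultimately show "\<exists>T\<in>dim2. v \<in> T \<and> (\<forall>U'\<in>?R. meets T U')"
    using crossing_dim2[OF \<open>x \<in> U1\<close> \<open>x \<noteq> 0\<close>] by blast
next
  fix T v assume T: "T \<in> dim2" "\<forall>U\<in>?R. meets T U" and v: "v \<in> T" "v \<noteq> 0"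
  have "U1 \<in> ?R" "U2 \<in> ?R" "U3 \<in> ?R" using ruling_simps by force+
  then have m: "meets T U1" "meets T U2" "meets T U3" using T by blast+
  then obtain p where p: "p \<noteq> 0" "p \<in> T" "p \<in> U1" by (auto simp: meets_def)
  have "p \<notin> U2" "p \<notin> U3" using p skew by (auto simp: meets_def)
  moreover have "p \<in> crossing p" by (simp add: crossing_def vec.span_base)
  ultimately have "T = crossing p"
    using T(1) m(2,3) p crossing_meets(2,3) crossing_dim2 sub(2,3) skew(3)
    by (intro transversal_through_unique[of T U2 U3 p "crossing p"])
  with v obtain a b where ab: "v = a *s p + b *s \<phi> p" by (auto simp: in_crossing)
  then have "a \<noteq> 0 \<or> b \<noteq> 0" "v \<in> ruling a b" using v p by (auto simp: ruling_def)
  then show "\<exists>U\<in>?R. v \<in> U" by blast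
qed

end

lemma vregulus_exists:
  fixes U1 U2 U3 :: "('a::{field,finite} ^ 4) set"
  assumes "U1 \<in> dim2" "U2 \<in> dim2" "U3 \<in> dim2"
    and "\<not> meets U1 U2" "\<not> meets U1 U3" "\<not> meets U2 U3"
  obtains \<R> where "vregulus \<R>" "U1 \<in> \<R>" "U2 \<in> \<R>" "U3 \<in> \<R>"
proof -
  obtain \<phi> where "regulus_frame U1 U2 U3 \<phi>" using obtain_regulus_frame assms by blast
  then interpret regulus_frame U1 U2 U3 \<phi> .
  have "ruling a b \<in> {ruling a b | a b. a \<noteq> 0 \<or> b \<noteq> 0}" if "a \<noteq> 0 \<or> b \<noteq> 0" for a b
    using that by blast
  from this[of 1 0] this[of 0 1] this[of 1 1] show thesis
    by (intro that[OF vregulus_rulings]) (simp_all add: ruling_simps)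
qed

text \<open>The roles of lines and transversals are exchanged. The three crossings are transversals
  of both reguli, so a member of either regulus is the unique line through its point on
  \<open>T1\<close> that meets \<open>T2\<close> and \<open>T3\<close>.\<close>

lemma vregulus_subset:
  fixes U1 U2 U3 :: "('a::{field,finite} ^ 4) set"
  assumes R: "vregulus \<R>" "U1 \<in> \<R>" "U2 \<in> \<R>" "U3 \<in> \<R>"
    and R': "vregulus \<R>'" "U1 \<in> \<R>'" "U2 \<in> \<R>'" "U3 \<in> \<R>'"
    and ne: "U1 \<noteq> U2" "U1 \<noteq> U3" "U2 \<noteq> U3"
  shows "\<R> \<subseteq> \<R>'"
proof
  fix L assume L: "L \<in> \<R>"
  have "U1 \<in> dim2" "U2 \<in> dim2" "U3 \<in> dim2"
    and "\<not> meets U1 U2" "\<not> meets U1 U3" "\<not> meets U2 U3"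
    using vregulus_dim2[OF R(1)] vregulus_skew[OF R(1)] R ne by simp_all
  then obtain \<phi> where "regulus_frame U1 U2 U3 \<phi>" using obtain_regulus_frame by blast
  then interpret regulus_frame U1 U2 U3 \<phi> .
  obtain T1 T2 T3 where T: "{T1, T2, T3} \<subseteq> dim2"
    and sk: "\<not> meets T1 T2" "\<not> meets T1 T3" "\<not> meets T2 T3"
    and m: "\<forall>T\<in>{T1, T2, T3}. meets T U1 \<and> meets T U2 \<and> meets T U3"
    by (rule three_skew_crossings)
  have mR: "meets T U" if "T \<in> {T1, T2, T3}" "U \<in> \<R>" for T U
    using vregulus_transversal[OF R ne, of T U] T m that by blast
  have mR': "meets T U" if "T \<in> {T1, T2, T3}" "U \<in> \<R>'" for T U
    using vregulus_transversal[OF R' ne, of T U] T m that by blast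
  obtain v where v: "v \<noteq> 0" "v \<in> T1" "v \<in> L" using mR[of T1 L] L by (auto simp: meets_def)
  obtain L' where L': "L' \<in> \<R>'" "v \<in> L'"
    using vregulus_cover[OF R'(1), of T1 v] T mR' v by auto
  have "L = L'"
  proof (rule transversal_through_unique)
    show "L \<in> dim2" "L' \<in> dim2"
      using vregulus_dim2[OF R(1)] vregulus_dim2[OF R'(1)] L L' by simp_all
    show "meets L T2" "meets L T3" "meets L' T2" "meets L' T3"
      using mR[OF _ L] mR'[OF _ L'(1)] by (simp_all add: meets_commute[of L] meets_commute[of L'])
    show "v \<notin> T2" "v \<notin> T3" using v sk by (auto simp: meets_def)
  qed (use T sk v L' in \<open>auto simp: dim2_def\<close>)
  with L' show "L \<in> \<R>'" by simp
qed

text \<open>This evaluates the definite description in \<open>regulus_through\<close>; its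
  uniqueness part is \<open>vregulus_subset\<close> applied in both directions.\<close>

lemma regulus_through_projectivization:
  fixes U1 U2 U3 :: "('a::{field,finite} ^ 4) set"
  assumes R: "vregulus \<R>" "U1 \<in> \<R>" "U2 \<in> \<R>" "U3 \<in> \<R>"
    and ne: "U1 \<noteq> U2" "U1 \<noteq> U3" "U2 \<noteq> U3"
  shows "regulus_through (projectivization U1) (projectivization U2) (projectivization U3) =
    projectivization ` \<R>"
  unfolding regulus_through_def
proof (rule the_equality)
  have "\<R> \<subseteq> dim2" using vregulus_dim2[OF R(1)] by blast
  then show "regulus (projectivization ` \<R>) \<and>
      {projectivization U1, projectivization U2, projectivization U3} \<subseteq> projectivization ` \<R>"
    using R regulus_projectivization by auto
next
  fix R' assume R': "regulus R' \<and> {projectivization U1, projectivization U2, projectivization U3} \<subseteq> R'"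
  let ?\<R>' = "{U \<in> dim2. projectivization U \<in> R'}"
  have "R' \<subseteq> projectivization ` dim2" using R' by (simp add: regulus_def pg_lines_eq)
  then have eq: "R' = projectivization ` ?\<R>'" by auto
  then have "vregulus ?\<R>'" using regulus_projectivization[of ?\<R>'] R' by simp
  moreover have "U1 \<in> ?\<R>'" "U2 \<in> ?\<R>'" "U3 \<in> ?\<R>'"
    using R' vregulus_dim2[OF R(1)] R(2-4) by simp_all
  ultimately have "?\<R>' = \<R>"
    using vregulus_subset[of ?\<R>' U1 U2 U3 \<R>] vregulus_subset[of \<R> U1 U2 U3 ?\<R>'] R ne
    by (intro equalityI) simp_all
  with eq show "R' = projectivization ` \<R>" by simp
qed

subsection \<open>The inversive plane of a regular spread\<close>

definition spread_lines :: "('a::field ^ 4) set set set \<Rightarrow> ('a ^ 4) set set" where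
  "spread_lines S = {U \<in> dim2. projectivization U \<in> S}"

text \<open>Circles are indexed by a transversal because that is the kernel of a repair matrix. In a
  spread, a spread line \<open>K\<close> would give just \<open>{K}\<close>, so circles are taken
  over \<open>dim2 - spread_lines S\<close>.\<close>

definition circle_of :: "('a::field ^ 4) set set set \<Rightarrow> ('a ^ 4) set \<Rightarrow> ('a ^ 4) set set" where
  "circle_of S K = {U \<in> spread_lines S. meets K U}"

lemma spread_lines_dim2: "U \<in> spread_lines S \<Longrightarrow> U \<in> dim2"
  by (simp add: spread_lines_def)

lemma spread_cover:
  assumes "spread S" "v \<noteq> 0"
  obtains U where "U \<in> spread_lines S" "v \<in> U"
proof -
  have S: "\<Union>S = pg_points" "S \<subseteq> projectivization ` dim2"
    using assms(1) by (auto simp: spread_def partition_on_def pg_lines_eq)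
  have "vec.span {v} \<in> pg_points" using assms(2) pg_points_iff by blast
  then obtain L where L: "L \<in> S" "vec.span {v} \<in> L" using S(1) by blast
  then obtain U where "U \<in> dim2" "L = projectivization U" using S(2) by blast
  with L that assms(2) show thesis
    by (simp add: spread_lines_def span_singleton_in_projectivization dim2_subspace)
qed

lemma spread_skew:
  assumes "spread S" "U \<in> spread_lines S" "U' \<in> spread_lines S" "meets U U'"
  shows "U = U'"
proof -
  have sub: "vec.subspace U" "vec.subspace U'"
    using assms by (auto simp: spread_lines_def dim2_def)
  have "disjoint S" using assms(1) by (simp add: spread_def partition_on_def)
  moreover have "projectivization U \<inter> projectivization U' \<noteq> {}"
    using projectivization_Int[OF sub] assms(4) by simp
  ultimately have "projectivization U = projectivization U'"
    using assms(2,3) by (auto simp: spread_lines_def disjoint_def)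
  then show ?thesis using projectivization_eqI[OF sub] by simp
qed

text \<open>Every member of the family takes q^d - 1 of the nonzero vectors of \<open>W\<close>.
  With \<open>W\<close> the whole space and d = 2 this counts a spread; with \<open>W\<close> a line
  off the spread and d = 1 it counts a circle.\<close>

lemma card_partition_nonzero:
  fixes W :: "('a::{field,finite} ^ 'n) set"
  assumes W: "vec.subspace W" and F: "\<And>U. U \<in> \<F> \<Longrightarrow> vec.subspace U \<and> vec.dim (W \<inter> U) = d"
    and cover: "\<And>v. \<lbrakk>v \<in> W; v \<noteq> 0\<rbrakk> \<Longrightarrow> \<exists>U\<in>\<F>. v \<in> U"
    and skew: "\<And>U U'. \<lbrakk>U \<in> \<F>; U' \<in> \<F>; meets U U'\<rbrakk> \<Longrightarrow> U = U'"
  shows "card \<F> * (CARD('a) ^ d - 1) = CARD('a) ^ vec.dim W - 1"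
proof -
  have "(\<Union>U\<in>\<F>. W \<inter> U - {0}) = W - {0}" using cover by blast
  moreover have "card (\<Union>U\<in>\<F>. W \<inter> U - {0}) = (\<Sum>U\<in>\<F>. card (W \<inter> U - {0}))"
    using skew by (intro card_UN_disjoint) (auto simp: meets_def)
  moreover have "(\<Sum>U\<in>\<F>. card (W \<inter> U - {0})) = (\<Sum>U\<in>\<F>. CARD('a) ^ d - 1)"
  proof (rule sum.cong)
    fix U assume "U \<in> \<F>"
    then have "vec.subspace (W \<inter> U)" "vec.dim (W \<inter> U) = d" using F W vec.subspace_inter by auto
    then show "card (W \<inter> U - {0}) = CARD('a) ^ d - 1"
      using card_subspace[of "W \<inter> U"] vec.subspace_0[of "W \<inter> U"] by (simp add: card_Diff_singleton)
  qed simp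
  moreover have "card (W - {0}) = CARD('a) ^ vec.dim W - 1"
    using card_subspace[OF W] vec.subspace_0[OF W] by (simp add: card_Diff_singleton)
  ultimately show ?thesis by simp
qed

lemma card_spread_lines:
  fixes S :: "('a::{field,finite} ^ 4) set set set"
  assumes S: "spread S"
  shows "card (spread_lines S) = CARD('a)\<^sup>2 + 1"
proof -
  let ?q = "CARD('a)"
  have "card (spread_lines S) * (?q ^ 2 - 1) = ?q ^ vec.dim (UNIV :: ('a ^ 4) set) - 1"
  proof (rule card_partition_nonzero)
    fix v :: "'a ^ 4" assume "v \<noteq> 0"
    then show "\<exists>U\<in>spread_lines S. v \<in> U" using spread_cover[OF S] by metis
  qed (use spread_skew[OF S] in \<open>auto simp: spread_lines_def dim2_def\<close>)
  also have "\<dots> = ?q ^ 4 - 1" by (simp add: card_cart_basis)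
  also have "\<dots> = (?q\<^sup>2 + 1) * (?q\<^sup>2 - 1)"
    by (simp add: algebra_simps flip: power_add)
  finally show ?thesis
    using card_field_ge_2[where 'a='a] power_mono[of 2 ?q 2] by (subst (asm) mult_cancel2) auto
qed

lemma dim_Int_dim2:
  assumes "K \<in> dim2" "U \<in> dim2" "K \<noteq> U" "meets K U"
  shows "vec.dim (K \<inter> U) = 1"
proof -
  have "vec.dim (K \<inter> U) \<noteq> 0" using assms(4) vec.dim_eq_0[of "K \<inter> U"] by (auto simp: meets_def)
  moreover have "vec.dim (K \<inter> U) \<noteq> 2"
  proof
    assume "vec.dim (K \<inter> U) = 2"
    then have "K \<inter> U \<in> dim2" using assms by (simp add: dim2_def vec.subspace_inter)
    then show False using dim2_subset_eq[of "K \<inter> U"] assms by blast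
  qed
  moreover have "vec.dim (K \<inter> U) \<le> 2"
    using vec.dim_subset[of "K \<inter> U" K] assms by (simp add: dim2_def)
  ultimately show ?thesis by linarith
qed

lemma card_circle_of:
  fixes S :: "('a::{field,finite} ^ 4) set set set"
  assumes S: "spread S" and K: "K \<in> dim2" "K \<notin> spread_lines S"
  shows "card (circle_of S K) = CARD('a) + 1"
proof -
  let ?q = "CARD('a)"
  have "card (circle_of S K) * (?q ^ 1 - 1) = ?q ^ vec.dim K - 1"
  proof (rule card_partition_nonzero)
    fix v assume v: "v \<in> K" "v \<noteq> 0"
    then obtain U where "U \<in> spread_lines S" "v \<in> U" using spread_cover[OF S] by metis
    with v show "\<exists>U\<in>circle_of S K. v \<in> U" by (auto simp: circle_of_def meets_def)
  next
    fix U assume "U \<in> circle_of S K"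
    then have "U \<in> dim2" "U \<noteq> K" "meets K U" using K by (auto simp: circle_of_def spread_lines_def)
    then show "vec.subspace U \<and> vec.dim (K \<inter> U) = 1"
      using dim_Int_dim2[OF K(1)] by (auto simp: dim2_def)
  qed (use spread_skew[OF S] K in \<open>auto simp: circle_of_def dim2_def\<close>)
  also have "\<dots> = ?q\<^sup>2 - 1" using K by (simp add: dim2_def)
  also have "\<dots> = (?q + 1) * (?q ^ 1 - 1)" by (simp add: power2_eq_square algebra_simps)
  finally show ?thesis
    using card_field_ge_2[where 'a='a] by (subst (asm) mult_cancel2) auto
qed

text \<open>Regularity puts the regulus inside the spread, and its members all meet \<open>K\<close>
  because three of them do. Conversely, each point of \<open>K\<close> is on a member of the
  regulus, and only one spread line passes through that point.\<close>

lemma circle_of_eq_regulus: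
  fixes S :: "('a::{field,finite} ^ 4) set set set"
  assumes S: "regular_spread S" and K: "K \<in> dim2"
    and U: "U1 \<in> circle_of S K" "U2 \<in> circle_of S K" "U3 \<in> circle_of S K"
    and ne: "U1 \<noteq> U2" "U1 \<noteq> U3" "U2 \<noteq> U3"
    and R: "vregulus \<R>" "U1 \<in> \<R>" "U2 \<in> \<R>" "U3 \<in> \<R>"
  shows "circle_of S K = \<R>"
proof -
  have sp: "spread S" using S by (simp add: regular_spread_def)
  have UC: "U1 \<in> spread_lines S" "U2 \<in> spread_lines S" "U3 \<in> spread_lines S"
    using U by (auto simp: circle_of_def)
  have "projectivization U \<noteq> projectivization U'"
    if "U \<in> spread_lines S" "U' \<in> spread_lines S" "U \<noteq> U'" for U U'
    using that projectivization_eqI[of U U'] by (auto simp: spread_lines_def dim2_def)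
  then have "projectivization ` \<R> \<subseteq> S"
    using S UC ne regulus_through_projectivization[OF R ne]
    unfolding regular_spread_def spread_lines_def by (metis (no_types, lifting) mem_Collect_eq)
  then have RC: "\<R> \<subseteq> spread_lines S" using vregulus_dim2[OF R(1)] by (auto simp: spread_lines_def)
  have m: "meets K U" if "U \<in> \<R>" for U
    using vregulus_transversal[OF R ne K] that U by (simp add: circle_of_def)
  show ?thesis
  proof
    show "\<R> \<subseteq> circle_of S K" using RC m by (auto simp: circle_of_def)
    show "circle_of S K \<subseteq> \<R>"
    proof
      fix U assume "U \<in> circle_of S K"
      then obtain v where v: "v \<noteq> 0" "v \<in> K" "v \<in> U" and "U \<in> spread_lines S"
        by (auto simp: circle_of_def meets_def)
      then obtain U' where U': "U' \<in> \<R>" "v \<in> U'" using vregulus_cover[OF R(1) K m] by metis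
      then have "U = U'" using spread_skew[OF sp \<open>U \<in> spread_lines S\<close>, of U'] v RC
        by (auto simp: meets_def)
      with U' show "U \<in> \<R>" by simp
    qed
  qed
qed

text \<open>Any transversal of the regulus can serve as \<open>K\<close>. It is not a spread line,
  since a spread line meeting both \<open>U1\<close> and \<open>U2\<close> would equal both.\<close>

lemma obtain_circle_regulus:
  fixes S :: "('a::{field,finite} ^ 4) set set set"
  assumes S: "spread S" and U: "U1 \<in> spread_lines S" "U2 \<in> spread_lines S" "U3 \<in> spread_lines S"
    and ne: "U1 \<noteq> U2" "U1 \<noteq> U3" "U2 \<noteq> U3"
  obtains K \<R> where "K \<in> dim2" "K \<notin> spread_lines S" "{U1, U2, U3} \<subseteq> circle_of S K"
    "vregulus \<R>" "U1 \<in> \<R>" "U2 \<in> \<R>" "U3 \<in> \<R>"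
proof -
  have d: "U1 \<in> dim2" "U2 \<in> dim2" "U3 \<in> dim2" using U spread_lines_dim2 by auto
  have sk: "\<not> meets U1 U2" "\<not> meets U1 U3" "\<not> meets U2 U3"
    using spread_skew[OF S] U ne by blast+
  obtain \<R> where R: "vregulus \<R>" "U1 \<in> \<R>" "U2 \<in> \<R>" "U3 \<in> \<R>"
    by (rule vregulus_exists[OF d sk])
  obtain v where "v \<in> U1" "v \<noteq> 0" using dim2_nonzero[OF d(1)] by blast
  then obtain K where K: "K \<in> dim2" "\<And>U. U \<in> \<R> \<Longrightarrow> meets K U"
    using vregulus_transversal_through[OF R(1,2)] by metis
  have m: "meets K U1" "meets K U2" "meets K U3" using K(2) R(2-4) by blast+
  have "K \<notin> spread_lines S"
  proof
    assume "K \<in> spread_lines S"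
    then have "K = U1" "K = U2" using spread_skew[OF S] U m by blast+
    with ne show False by simp
  qed
  with that K R m U show thesis by (simp add: circle_of_def)
qed

lemma regular_spread_inversive_plane:
  fixes S :: "('a::{field,finite} ^ 4) set set set"
  assumes S: "regular_spread S" and q: "CARD('a) \<ge> 3"
  shows "inversive_plane (spread_lines S) (circle_of S ` (dim2 - spread_lines S)) CARD('a)"
proof
  have sp: "spread S" using S by (simp add: regular_spread_def)
  show "finite (spread_lines S)" by simp
  show "card (spread_lines S) = CARD('a)\<^sup>2 + 1" by (rule card_spread_lines[OF sp])
  fix B assume "B \<in> circle_of S ` (dim2 - spread_lines S)"
  then show "B \<subseteq> spread_lines S" "card B = CARD('a) + 1"
    using card_circle_of[OF sp] by (auto simp: circle_of_def)
next
  have sp: "spread S" using S by (simp add: regular_spread_def)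
  fix U1 U2 U3
  assume "U1 \<in> spread_lines S" "U2 \<in> spread_lines S" "U3 \<in> spread_lines S" "U1 \<noteq> U2" "U1 \<noteq> U3" "U2 \<noteq> U3"
  then show "\<exists>B\<in>circle_of S ` (dim2 - spread_lines S). U1 \<in> B \<and> U2 \<in> B \<and> U3 \<in> B"
    by (rule obtain_circle_regulus[OF sp]) auto
next
  have sp: "spread S" using S by (simp add: regular_spread_def)
  fix B B' U1 U2 U3
  assume B: "B \<in> circle_of S ` (dim2 - spread_lines S)" "B' \<in> circle_of S ` (dim2 - spread_lines S)"
    and U: "{U1, U2, U3} \<subseteq> B" "{U1, U2, U3} \<subseteq> B'" and ne: "U1 \<noteq> U2" "U1 \<noteq> U3" "U2 \<noteq> U3"
  obtain K K' where K: "B = circle_of S K" "K \<in> dim2" and K': "B' = circle_of S K'" "K' \<in> dim2"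
    using B by blast
  have UC: "U1 \<in> spread_lines S" "U2 \<in> spread_lines S" "U3 \<in> spread_lines S"
    using U K by (auto simp: circle_of_def)
  obtain \<R> where R: "vregulus \<R>" "U1 \<in> \<R>" "U2 \<in> \<R>" "U3 \<in> \<R>"
    using obtain_circle_regulus[OF sp UC ne] by metis
  show "B = B'"
    using circle_of_eq_regulus[OF S K(2) _ _ _ ne R] circle_of_eq_regulus[OF S K'(2) _ _ _ ne R] U K K'
    by simp
qed (rule q)

subsection \<open>Ranks and kernels\<close>

lemma column_matrix_matrix_mult: "column b (M ** A) = M *v column b A"
  by (simp add: column_def matrix_matrix_mult_def matrix_vector_mult_def vec_eq_iff)

text \<open>All rows are supported on the nonzero columns, hence lie in a coordinate subspace of
  dimension \<open>nz A\<close>.\<close>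

lemma rank_le_nz:
  fixes A :: "'a::field ^ 'n ^ 'm"
  shows "rank A \<le> nz A"
proof -
  let ?Z = "{b. column b A \<noteq> 0}"
  have "rows A \<subseteq> {x. \<forall>b. b \<notin> ?Z \<longrightarrow> x $ b = 0}"
    by (auto simp: rows_def row_def column_def vec_eq_iff)
  then have "vec.dim (rows A) \<le> vec.dim {x :: 'a ^ 'n. \<forall>b. b \<notin> ?Z \<longrightarrow> x $ b = 0}"
    by (rule vec.dim_subset)
  then show ?thesis
    unfolding row_rank_def_gen nz_def dim_substandard_cart .
qed

lemma rank_right_invertible:
  fixes A :: "'a::field ^ 'n ^ 'm" and B :: "'a ^ 'm ^ 'n"
  assumes "A ** B = mat 1"
  shows "rank A = CARD('m)"
proof (rule antisym)
  have "rows A = range (\<lambda>i. row i A)" by (auto simp: rows_def)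
  then have "rank A \<le> card (range (\<lambda>i. row i A))"
    unfolding row_rank_def_gen by (intro vec.dim_le_card) (auto intro: vec.span_base)
  also have "\<dots> \<le> CARD('m)" by (rule card_image_le) simp
  finally show "rank A \<le> CARD('m)" .
  have "transpose B ** transpose A = mat 1"
    using assms by (metis matrix_transpose_mul transpose_mat)
  then have "inj ((*v) (transpose A))"
    using matrix_left_invertible_injective by blast
  then have "vec.dim (range ((*v) (transpose A))) = vec.dim (UNIV :: ('a ^ 'm) set)"
    by (intro vec.dim_image_eq) (auto intro: inj_on_subset)
  also have "\<dots> = CARD('m)" by (simp add: card_cart_basis)
  finally have "vec.dim (range ((*v) (transpose A))) = CARD('m)" .
  moreover have "range ((*v) (transpose A)) \<subseteq> vec.span (rows A)"
    using matrix_vector_mult_in_columnspace_gen[of "transpose A"] by (auto simp: columns_transpose)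
  ultimately show "CARD('m) \<le> rank A"
    unfolding row_rank_def_gen by (metis vec.dim_mono)
qed

lemma kernel_subspace: "vec.subspace {x. (M :: 'a::field ^ 'n ^ 'm) *v x = 0}"
  by (auto simp: vec.subspace_def matrix_vector_right_distrib vector_scalar_commute)

text \<open>The product \<open>B ** A\<close> is a projection, which splits the space into the
  kernel of \<open>A\<close> and the range of \<open>B\<close>.\<close>

lemma dim_kernel_right_invertible:
  fixes A :: "'a::field ^ 'n ^ 'm" and B :: "'a ^ 'm ^ 'n"
  assumes "A ** B = mat 1"
  shows "vec.dim {x. A *v x = 0} + CARD('m) = CARD('n)"
proof -
  let ?R = "range ((*v) B)" and ?K = "{x. A *v x = 0}"
  have AB: "A *v (B *v y) = y" for y by (simp add: matrix_vector_mul_assoc assms)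
  then have "inj ((*v) B)" by (metis injI)
  then have "vec.dim ?R = vec.dim (UNIV :: ('a ^ 'm) set)"
    by (intro vec.dim_image_eq) (auto intro: inj_on_subset)
  then have "vec.dim ?R = CARD('m)" by (simp add: card_cart_basis)
  moreover have K: "vec.subspace ?K" by (rule kernel_subspace)
  moreover have R: "vec.subspace ?R" by (intro vec.subspace_image) simp
  moreover have "?K \<inter> ?R = {0}"
    using AB by (auto intro: image_eqI[of _ _ 0])
  moreover have "{x + y |x y. x \<in> ?K \<and> y \<in> ?R} = UNIV"
  proof -
    have "z = (z - B *v (A *v z)) + B *v (A *v z)" "A *v (z - B *v (A *v z)) = 0" for z
      by (simp_all add: AB matrix_vector_mult_diff_distrib)
    then show ?thesis by blast
  qed
  ultimately show ?thesis
    using vec.dim_sums_Int[OF K R] by (simp add: card_cart_basis)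
qed

lemma rank_square_injective:
  fixes A :: "'a::field ^ 'm ^ 'm"
  assumes "\<And>x. A *v x = 0 \<Longrightarrow> x = 0"
  shows "rank A = CARD('m)"
proof -
  obtain B where "B ** A = mat 1" using assms matrix_left_invertible_ker[of A] by auto
  then have "A ** B = mat 1" by (rule matrix_left_right_inverse1)
  then show ?thesis by (rule rank_right_invertible)
qed

lemma rank_pos:
  fixes A :: "'a::field ^ 'n ^ 'm"
  assumes "A \<noteq> 0"
  shows "1 \<le> rank A"
proof -
  obtain i where "row i A \<noteq> 0" using assms by (auto simp: row_def vec_eq_iff)
  then have "rank A \<noteq> 0" unfolding row_rank_def_gen vec.dim_eq_0 by (auto simp: rows_def)
  then show ?thesis by simp
qed

subsection \<open>Node spaces\<close>

definition node_space :: "'a::field ^ ('n::finite \<times> 'l::finite) ^ 'm \<Rightarrow> 'n \<Rightarrow> ('a ^ 'm) set" where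
  "node_space H i = vec.span (columns (mat_block H i))"

lemma node_line_node_space: "node_line H i = projectivization (node_space H i)"
  by (simp add: node_line_def node_space_def)

lemma node_space_2:
  fixes H :: "'a::field ^ ('n::finite \<times> 2) ^ 'm"
  shows "node_space H i = vec.span {column 1 (mat_block H i), column 2 (mat_block H i)}"
proof -
  have "columns (mat_block H i) = {column 1 (mat_block H i), column 2 (mat_block H i)}"
    using forall_2 unfolding columns_def by (auto simp: UNIV_2)
  then show ?thesis by (simp add: node_space_def)
qed

lemma node_space_range:
  fixes H :: "'a::field ^ ('n::finite \<times> 2) ^ 'm"
  shows "node_space H i = range ((*v) (mat_block H i))"
proof (rule set_eqI)
  fix v
  let ?A = "mat_block H i"
  have "v \<in> node_space H i \<longleftrightarrow> (\<exists>a b. v = a *s column 1 ?A + b *s column 2 ?A)"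
    by (simp add: node_space_2 in_span_pair)
  also have "\<dots> \<longleftrightarrow> (\<exists>x. v = ?A *v x)"
  proof
    assume "\<exists>a b. v = a *s column 1 ?A + b *s column 2 ?A"
    then obtain a b where "v = a *s column 1 ?A + b *s column 2 ?A" by blast
    then have "v = ?A *v (vector [a, b])" by (simp add: matrix_mult_sum sum_2)
    then show "\<exists>x. v = ?A *v x" ..
  qed (auto simp: matrix_mult_sum sum_2)
  finally show "v \<in> node_space H i \<longleftrightarrow> v \<in> range ((*v) ?A)" by blast
qed

lemma span_pair_dim2_iff:
  "vec.span {x, y} \<in> dim2 \<longleftrightarrow> (\<forall>a b. a *s x + b *s y = 0 \<longrightarrow> a = 0 \<and> b = 0)"
proof
  assume D: "vec.span {x, y} \<in> dim2"
  have x: "x \<notin> vec.span {y}" and y: "y \<noteq> 0"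
    using D by (auto simp: dim2_def vec.dim_insert split: if_splits)
  show "\<forall>a b. a *s x + b *s y = 0 \<longrightarrow> a = 0 \<and> b = 0"
  proof (intro allI impI)
    fix a b assume eq: "a *s x + b *s y = 0"
    have "a = 0"
    proof (rule ccontr)
      assume "a \<noteq> 0"
      then have "x = inverse a *s (a *s x)" by simp
      also have "a *s x = (- b) *s y" using eq by (simp add: eq_neg_iff_add_eq_0)
      finally show False using x by (metis rangeI vec.span_singleton vec.scale_scale)
    qed
    with eq y show "a = 0 \<and> b = 0" by simp
  qed
next
  assume I: "\<forall>a b. a *s x + b *s y = 0 \<longrightarrow> a = 0 \<and> b = 0"
  show "vec.span {x, y} \<in> dim2"
  proof (rule dim2_spanI)
    show "x \<noteq> 0" using I[rule_format, of 1 0] by auto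
    show "y \<notin> vec.span {x}"
    proof
      assume "y \<in> vec.span {x}"
      then obtain k where "y = k *s x" by (auto simp: vec.span_singleton)
      then show False using I[rule_format, of k "- 1"] by simp
    qed
  qed
qed

text \<open>For r = 2 the index sets are pairs \<open>{i, j}\<close>, and invertibility says that
  the two columns of block \<open>i\<close> together with the two columns of block \<open>j\<close>
  are linearly independent.\<close>

lemma mds_iff_skew:
  fixes H :: "'a::field ^ ('n::finite \<times> 2) ^ 4"
  assumes n: "CARD('n) \<ge> 2"
  shows "mds (CARD('n) - 2) H \<longleftrightarrow>
    (\<forall>i j. i \<noteq> j \<longrightarrow> node_space H i \<in> dim2 \<and> node_space H j \<in> dim2 \<and>
      \<not> meets (node_space H i) (node_space H j))"
proof -
  let ?w = "\<lambda>p. column (snd p) (mat_block H (fst p))"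
  \<comment> \<open>Transporting coefficients along \<open>e\<close> gives a criterion in which the
    enumeration no longer appears.\<close>
  have inv: "invertible ((\<chi> a b. H $ a $ e b) :: 'a ^ 4 ^ 4) \<longleftrightarrow>
      (\<forall>d. (\<Sum>p\<in>I \<times> UNIV. d p *s ?w p) = 0 \<longrightarrow> (\<forall>p\<in>I \<times> UNIV. d p = 0))"
    if e: "bij_betw e (UNIV :: 4 set) (I \<times> (UNIV :: 2 set))" for I :: "'n set" and e
  proof -
    have col: "column b (\<chi> a b. H $ a $ e b) = ?w (e b)" for b
      by (simp add: column_def mat_block_def vec_eq_iff)
    have "invertible ((\<chi> a b. H $ a $ e b) :: 'a ^ 4 ^ 4) \<longleftrightarrow>
        (\<forall>c. (\<Sum>b\<in>UNIV. c b *s ?w (e b)) = 0 \<longrightarrow> (\<forall>b. c b = 0))"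
      unfolding invertible_left_inverse matrix_left_invertible_independent_columns col ..
    also have "\<dots> \<longleftrightarrow> (\<forall>d. (\<Sum>b\<in>UNIV. d (e b) *s ?w (e b)) = 0 \<longrightarrow> (\<forall>b. d (e b) = 0))"
    proof (intro iffI allI impI)
      fix c :: "4 \<Rightarrow> 'a" and b
      assume *: "\<forall>d. (\<Sum>b\<in>UNIV. d (e b) *s ?w (e b)) = 0 \<longrightarrow> (\<forall>b. d (e b) = 0)"
        "(\<Sum>b\<in>UNIV. c b *s ?w (e b)) = 0"
      have "inv_into UNIV e (e b) = b" for b using e by (simp add: bij_betw_def inv_into_f_f)
      then show "c b = 0" using *(1)[rule_format, of "c \<circ> inv_into UNIV e" b] *(2) by simp
    next
      fix d b
      assume "\<forall>c. (\<Sum>b\<in>UNIV. c b *s ?w (e b)) = 0 \<longrightarrow> (\<forall>b. c b = 0)"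
        "(\<Sum>b\<in>UNIV. d (e b) *s ?w (e b)) = 0"
      then show "d (e b) = 0" by (elim allE[of _ "\<lambda>b. d (e b)"]) simp
    qed
    also have "\<dots> \<longleftrightarrow> (\<forall>d. (\<Sum>p\<in>I \<times> UNIV. d p *s ?w p) = 0 \<longrightarrow> (\<forall>p\<in>I \<times> UNIV. d p = 0))"
    proof -
      have "(\<Sum>b\<in>UNIV. d (e b) *s ?w (e b)) = (\<Sum>p\<in>I \<times> UNIV. d p *s ?w p)" for d :: "'n \<times> 2 \<Rightarrow> 'a"
        using sum.reindex_bij_betw[OF e, of "\<lambda>p. d p *s ?w p"] by simp
      moreover have "(\<forall>b. d (e b) = 0) \<longleftrightarrow> (\<forall>p\<in>I \<times> UNIV. d p = 0)" for d :: "'n \<times> 2 \<Rightarrow> 'a"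
        using bij_betw_imp_surj_on[OF e] by (metis rangeE rangeI)
      ultimately show ?thesis by simp
    qed
    finally show ?thesis .
  qed
  \<comment> \<open>The condition in \<open>mds\<close> quantifies over enumerations, so it says
    something about \<open>I\<close> only because 4 = 2 * 2 makes one exist.\<close>
  have ex: "\<exists>e. bij_betw e (UNIV :: 4 set) (I \<times> (UNIV :: 2 set))" if "card I = 2" for I :: "'n set"
    using that by (intro finite_same_card_bij) (auto simp: card_cartesian_product)
  have pairs: "(\<forall>d. (\<Sum>p\<in>{i, j} \<times> UNIV. d p *s ?w p) = 0 \<longrightarrow> (\<forall>p\<in>{i, j} \<times> UNIV. d p = 0)) \<longleftrightarrow>
      node_space H i \<in> dim2 \<and> node_space H j \<in> dim2 \<and> \<not> meets (node_space H i) (node_space H j)"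
    (is "?ind \<longleftrightarrow> ?skew") if "i \<noteq> j" for i j
  proof -
    let ?x1 = "?w (i, 1)" and ?x2 = "?w (i, 2)" and ?y1 = "?w (j, 1)" and ?y2 = "?w (j, 2)"
    have S: "node_space H i = vec.span {?x1, ?x2}" "node_space H j = vec.span {?y1, ?y2}"
      by (simp_all add: node_space_2)
    have "(\<Sum>p\<in>{i, j} \<times> UNIV. d p *s ?w p) =
        d (i, 1) *s ?x1 + d (i, 2) *s ?x2 + (d (j, 1) *s ?y1 + d (j, 2) *s ?y2)"
      for d :: "'n \<times> 2 \<Rightarrow> 'a"
      using that sum.cartesian_product[of "\<lambda>i b. d (i, b) *s ?w (i, b)" UNIV "{i, j}"]
      by (simp add: sum_2 case_prod_beta)
    moreover have "(\<forall>p\<in>{i, j} \<times> UNIV. d p = 0) \<longleftrightarrow>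
        d (i, 1) = 0 \<and> d (i, 2) = 0 \<and> d (j, 1) = 0 \<and> d (j, 2) = 0" for d :: "'n \<times> 2 \<Rightarrow> 'a"
      by (auto simp: forall_2 UNIV_2)
    ultimately have "?ind \<longleftrightarrow> (\<forall>d :: 'n \<times> 2 \<Rightarrow> 'a. d (i, 1) *s ?x1 + d (i, 2) *s ?x2 + (d (j, 1) *s ?y1 + d (j, 2) *s ?y2) = 0
        \<longrightarrow> d (i, 1) = 0 \<and> d (i, 2) = 0 \<and> d (j, 1) = 0 \<and> d (j, 2) = (0::'a))" by simp
    also have "\<dots> \<longleftrightarrow> (\<forall>a b c d. a *s ?x1 + b *s ?x2 + (c *s ?y1 + d *s ?y2) = 0 \<longrightarrow>
        a = 0 \<and> b = 0 \<and> c = 0 \<and> d = (0::'a))" (is "?l \<longleftrightarrow> ?r")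
    proof
      assume l: ?l
      show ?r
      proof (intro allI)
        fix a b c d :: 'a
        \<comment> \<open>The final default branch supplies the coefficient at
          \<open>(j, 2)\<close>.\<close>
        let ?d = "\<lambda>p. if p = (i, 1) then a else if p = (i, 2) then b else if p = (j, 1) then c else d"
        show "a *s ?x1 + b *s ?x2 + (c *s ?y1 + d *s ?y2) = 0 \<longrightarrow> a = 0 \<and> b = 0 \<and> c = 0 \<and> d = 0"
          using l[rule_format, of ?d] that by auto
      qed
    qed blast
    also have "\<dots> \<longleftrightarrow> ?skew"
    proof
      assume r: ?r
      have "node_space H i \<in> dim2" "node_space H j \<in> dim2"
        unfolding S span_pair_dim2_iff
        using r[rule_format, of _ _ 0 0] r[rule_format, of 0 0] by auto
      moreover have "\<not> meets (node_space H i) (node_space H j)"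
      proof
        assume "meets (node_space H i) (node_space H j)"
        then obtain v a b c d where v: "v \<noteq> 0" "v = a *s ?x1 + b *s ?x2" "v = c *s ?y1 + d *s ?y2"
          unfolding meets_def S in_span_pair by blast
        then have "a *s ?x1 + b *s ?x2 + ((- c) *s ?y1 + (- d) *s ?y2) = v - v"
          by (simp add: algebra_simps)
        then show False using r[rule_format, of a b "- c" "- d"] v by simp
      qed
      ultimately show ?skew by blast
    next
      assume ?skew
      then have D: "vec.span {?x1, ?x2} \<in> dim2" "vec.span {?y1, ?y2} \<in> dim2"
        and sk: "\<not> meets (vec.span {?x1, ?x2}) (vec.span {?y1, ?y2})" by (simp_all add: S)
      show ?r
      proof (intro allI impI)
        fix a b c d assume eq: "a *s ?x1 + b *s ?x2 + (c *s ?y1 + d *s ?y2) = 0"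
        let ?v = "a *s ?x1 + b *s ?x2"
        have "?v = - (c *s ?y1 + d *s ?y2)"
          using eq by (subst eq_neg_iff_add_eq_0)
        then have "?v = (- c) *s ?y1 + (- d) *s ?y2"
          by simp
        then have "?v \<in> vec.span {?x1, ?x2}" "?v \<in> vec.span {?y1, ?y2}"
          unfolding in_span_pair by blast+
        then have "?v = 0" using sk by (auto simp: meets_def)
        moreover from this have "c *s ?y1 + d *s ?y2 = 0" using eq by simp
        ultimately show "a = 0 \<and> b = 0 \<and> c = 0 \<and> d = 0"
          using D unfolding span_pair_dim2_iff by blast
      qed
    qed
    finally show ?thesis .
  qed
  have "mds (CARD('n) - 2) H \<longleftrightarrow> (\<forall>I e. card I = 2 \<and> bij_betw e (UNIV :: 4 set) (I \<times> (UNIV :: 2 set))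
      \<longrightarrow> invertible ((\<chi> a b. H $ a $ e b) :: 'a ^ 4 ^ 4))"
    using n by (simp add: mds_def)
  also have "\<dots> \<longleftrightarrow> (\<forall>I. card I = 2 \<longrightarrow>
      (\<forall>d. (\<Sum>p\<in>I \<times> UNIV. d p *s ?w p) = 0 \<longrightarrow> (\<forall>p\<in>I \<times> UNIV. d p = 0)))"
    (is "?l \<longleftrightarrow> ?r")
  proof
    assume l: ?l
    show ?r
    proof (intro allI impI)
      fix I and d :: "'n \<times> 2 \<Rightarrow> 'a"
      assume I: "card I = 2" and d: "(\<Sum>p\<in>I \<times> UNIV. d p *s ?w p) = 0"
      obtain e where e: "bij_betw e (UNIV :: 4 set) (I \<times> (UNIV :: 2 set))" using ex[OF I] ..
      then have "invertible ((\<chi> a b. H $ a $ e b) :: 'a ^ 4 ^ 4)" using l I by simp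
      with d show "\<forall>p\<in>I \<times> UNIV. d p = 0" unfolding inv[OF e] by simp
    qed
  next
    assume r: ?r
    show ?l
    proof (intro allI impI)
      fix I :: "'n set" and e
      assume I: "card I = 2 \<and> bij_betw e (UNIV :: 4 set) (I \<times> (UNIV :: 2 set))"
      show "invertible ((\<chi> a b. H $ a $ e b) :: 'a ^ 4 ^ 4)"
        unfolding inv[OF conjunct2[OF I]] by (rule r[THEN spec, THEN mp, OF conjunct1[OF I]])
    qed
  qed
  also have "\<dots> \<longleftrightarrow> (\<forall>i j. i \<noteq> j \<longrightarrow>
      (\<forall>d. (\<Sum>p\<in>{i, j} \<times> UNIV. d p *s ?w p) = 0 \<longrightarrow> (\<forall>p\<in>{i, j} \<times> UNIV. d p = 0)))"
    unfolding card_2_iff by blast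
  finally show ?thesis using pairs by simp
qed

subsection \<open>Repair matrices\<close>

lemma node_block_injective:
  fixes H :: "'a::field ^ ('n::finite \<times> 2) ^ 'm"
  assumes "node_space H i \<in> dim2" "mat_block H i *v x = 0"
  shows "x = 0"
proof -
  have "x $ 1 *s column 1 (mat_block H i) + x $ 2 *s column 2 (mat_block H i) = 0"
    using assms(2) by (simp add: matrix_mult_sum sum_2)
  then have "x $ 1 = 0 \<and> x $ 2 = 0"
    using assms(1) unfolding node_space_2 span_pair_dim2_iff by blast
  then show ?thesis by (simp add: vec_eq_iff forall_2)
qed

text \<open>Invertibility of the product with block \<open>i\<close> gives \<open>M\<close> a right
  inverse, so its kernel has dimension 4 - 2, and makes \<open>M\<close> injective on the column
  space of that block.\<close>

lemma repair_matrix_kernel: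
  fixes H :: "'a::field ^ ('n::finite \<times> 2) ^ 4"
  assumes M: "M \<in> repair_matrices H i" and U: "node_space H i \<in> dim2"
  shows "{x. M *v x = 0} \<in> dim2" "\<not> meets {x. M *v x = 0} (node_space H i)"
proof -
  let ?B = "mat_block H i"
  obtain N where N: "M ** ?B ** N = mat 1" "N ** (M ** ?B) = mat 1"
    using M by (auto simp: repair_matrices_def invertible_def)
  then have "M ** (?B ** N) = mat 1" by (simp add: matrix_mul_assoc)
  then have "vec.dim {x. M *v x = 0} = 2" using dim_kernel_right_invertible by fastforce
  then show "{x. M *v x = 0} \<in> dim2" using kernel_subspace by (simp add: dim2_def)
  have "?B *v x = 0" if "M *v (?B *v x) = 0" for x
  proof -
    have "x = N *v (M *v (?B *v x))" by (simp add: matrix_vector_mul_assoc N(2))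
    with that show ?thesis by simp
  qed
  then show "\<not> meets {x. M *v x = 0} (node_space H i)"
    by (auto simp: meets_def node_space_range)
qed

text \<open>The matrix projects along \<open>K\<close> onto the node space and reads off coordinates
  in the columns of block \<open>i\<close>, so its product with that block is the identity.\<close>

lemma obtain_repair_matrix:
  fixes H :: "'a::field ^ ('n::finite \<times> 2) ^ 4"
  assumes U: "node_space H i \<in> dim2" and K: "K \<in> dim2" "\<not> meets K (node_space H i)"
  obtains M where "M \<in> repair_matrices H i" "{x. M *v x = 0} = K"
proof -
  let ?B = "mat_block H i"
  note subK = dim2_subspace[OF K(1)]
  have "\<exists>y. x - ?B *v y \<in> K" for x
  proof -
    obtain k u where k: "k \<in> K" and u: "u \<in> node_space H i" and x: "x = k + u"
      using skew_sum[OF K(1) U K(2), of x] by blast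
    obtain y where "u = ?B *v y" using u by (auto simp: node_space_range)
    then have "x - ?B *v y = k" using x by simp
    with k show ?thesis by metis
  qed
  then obtain g where g: "\<And>x. x - ?B *v g x \<in> K" by metis
  have uniq: "g x = y" if "x - ?B *v y \<in> K" for x y
  proof -
    have "(x - ?B *v y) - (x - ?B *v g x) \<in> K" by (rule vec.subspace_diff[OF subK that g])
    then have "?B *v (g x - y) \<in> K" by (simp add: matrix_vector_mult_diff_distrib)
    then have "?B *v (g x - y) = 0" using K(2) by (auto simp: meets_def node_space_range)
    then show ?thesis using node_block_injective[OF U] by fastforce
  qed
  have "g (x + y) = g x + g y" for x y
  proof (rule uniq)
    have "(x - ?B *v g x) + (y - ?B *v g y) \<in> K" by (rule vec.subspace_add[OF subK g g])
    then show "x + y - ?B *v (g x + g y) \<in> K" by (simp add: matrix_vector_right_distrib algebra_simps)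
  qed
  moreover have "g (c *s x) = c *s g x" for c x
  proof (rule uniq)
    have "c *s (x - ?B *v g x) \<in> K" by (rule vec.subspace_scale[OF subK g])
    then show "c *s x - ?B *v (c *s g x) \<in> K"
      by (simp add: vector_scalar_commute vec.scale_right_diff_distrib)
  qed
  ultimately have lin: "Vector_Spaces.linear (*s) (*s) g"
    by (simp add: Vector_Spaces.linear_iff vec.vector_space_axioms)
  have M: "matrix g *v x = g x" for x by (rule matrix_works[OF lin])
  have "(matrix g ** ?B) *v y = y" for y
  proof -
    have "g (?B *v y) = y" by (rule uniq) (use vec.subspace_0[OF subK] in simp)
    then show ?thesis by (simp add: M flip: matrix_vector_mul_assoc)
  qed
  then have "matrix g ** ?B = mat 1" by (simp add: matrix_eq)
  then have "matrix g \<in> repair_matrices H i"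
    by (simp add: repair_matrices_def invertible_def)
  moreover have "{x. matrix g *v x = 0} = K"
    using g uniq[of _ 0] by (auto simp: M) (metis diff_zero matrix_vector_mult_0_right)
  ultimately show thesis by (rule that)
qed

text \<open>The kernel of the repaired block corresponds to the intersection of the node space with
  the kernel of \<open>M\<close>, so every dimension of the rank that is lost comes from that
  intersection.\<close>

lemma rank_repair_block_ge:
  fixes H :: "'a::field ^ ('n::finite \<times> 2) ^ 4" and M :: "'a ^ 4 ^ 2"
  assumes U: "node_space H j \<in> dim2" and K: "{x. M *v x = 0} \<in> dim2"
  shows "\<not> meets {x. M *v x = 0} (node_space H j) \<Longrightarrow> rank (M ** mat_block H j) = 2"
    and "{x. M *v x = 0} \<noteq> node_space H j \<Longrightarrow> 1 \<le> rank (M ** mat_block H j)"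
proof -
  let ?A = "M ** mat_block H j"
  have A: "?A *v x = M *v (mat_block H j *v x)" for x by (simp add: matrix_vector_mul_assoc)
  assume "\<not> meets {x. M *v x = 0} (node_space H j)"
  then have "mat_block H j *v x = 0" if "?A *v x = 0" for x
    using that by (auto simp: A meets_def node_space_range)
  then show "rank ?A = 2"
    using node_block_injective[OF U] rank_square_injective[of ?A] by simp
next
  let ?A = "M ** mat_block H j"
  assume "{x. M *v x = 0} \<noteq> node_space H j"
  then have "\<not> node_space H j \<subseteq> {x. M *v x = 0}" using dim2_subset_eq[OF U K] by blast
  then obtain x where "M *v (mat_block H j *v x) \<noteq> 0"
    by (auto simp: node_space_range)
  then have "?A *v x \<noteq> 0" by (simp add: matrix_vector_mul_assoc)
  then have "?A \<noteq> 0" by auto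
  then show "1 \<le> rank ?A" by (rule rank_pos)
qed

text \<open>Unlike the bandwidth, the I/O drops only when a column of the block is itself in the
  kernel. If the kernel meets the node line in a point that is neither column, the rank is 1 but
  \<open>nz\<close> is 2.\<close>

lemma nz_repair_block_le:
  fixes H :: "'a::field ^ ('n::finite \<times> 2) ^ 'm"
  shows "nz (M ** mat_block H j) \<le> 2"
    and "M *v column b (mat_block H j) = 0 \<Longrightarrow> nz (M ** mat_block H j) \<le> 1"
proof -
  have "nz (M ** mat_block H j) \<le> CARD(2)" unfolding nz_def by (rule card_mono) auto
  then show "nz (M ** mat_block H j) \<le> 2" by simp
  assume "M *v column b (mat_block H j) = 0"
  then have "nz (M ** mat_block H j) \<le> card (UNIV - {b})"
    unfolding nz_def by (intro card_mono) (auto simp: column_matrix_matrix_mult)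
  then show "nz (M ** mat_block H j) \<le> 1" by (simp add: card_Diff_singleton)
qed

lemma repair_bandwidth_le_io: "repair_bandwidth H i M \<le> repair_io H i M"
  unfolding repair_bandwidth_def repair_io_def by (intro sum_mono rank_le_nz)

lemma beta_attained:
  fixes H :: "'a::{field,finite} ^ ('n::finite \<times> 2) ^ 4"
  assumes "repair_matrices H i \<noteq> {}"
  obtains M where "M \<in> repair_matrices H i" "beta H i = repair_bandwidth H i M"
proof -
  have "beta H i \<in> repair_bandwidth H i ` repair_matrices H i"
    unfolding beta_def using assms by (intro Min_in) auto
  then show thesis using that by blast
qed

lemma gamma_attained:
  fixes H :: "'a::{field,finite} ^ ('n::finite \<times> 2) ^ 4"
  assumes "repair_matrices H i \<noteq> {}"
  obtains M where "M \<in> repair_matrices H i" "gamma H i = repair_io H i M"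
proof -
  have "gamma H i \<in> repair_io H i ` repair_matrices H i"
    unfolding gamma_def using assms by (intro Min_in) auto
  then show thesis using that by blast
qed

lemma beta_le: "M \<in> repair_matrices H i \<Longrightarrow> beta H i \<le> repair_bandwidth H i M"
  by (simp add: beta_def)

lemma gamma_le: "M \<in> repair_matrices H i \<Longrightarrow> gamma H i \<le> repair_io H i M"
  by (simp add: gamma_def)

lemma beta_le_gamma:
  fixes H :: "'a::{field,finite} ^ ('n::finite \<times> 2) ^ 4"
  assumes "repair_matrices H i \<noteq> {}"
  shows "beta H i \<le> gamma H i"
proof -
  obtain M where M: "M \<in> repair_matrices H i" "gamma H i = repair_io H i M"
    by (rule gamma_attained[OF assms])
  have "beta H i \<le> repair_bandwidth H i M" by (rule beta_le[OF M(1)])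
  also have "\<dots> \<le> repair_io H i M" by (rule repair_bandwidth_le_io)
  finally show ?thesis using M(2) by simp
qed

section \<open>Codes with node lines in a regular spread\<close>

locale spread_code =
  fixes S :: "('a::{field,finite} ^ 4) set set set"
    and H :: "'a ^ ('n::finite \<times> 2) ^ 4"
  assumes regular: "regular_spread S" and q: "CARD('a) \<ge> 3" and n: "CARD('n) \<ge> 3"
    and node_spaces: "node_space H i \<in> spread_lines S"
    and inj_node_space: "inj (node_space H)"
begin

abbreviation "U \<equiv> node_space H"

lemma spread: "spread S"
  using regular by (simp add: regular_spread_def)

lemma U_dim2: "U i \<in> dim2"
  using node_spaces spread_lines_dim2 by blast

text \<open>Inside a spread the MDS condition amounts to distinctness of the node lines, which is
  why the locale asks for injectivity.\<close>

lemma U_skew: "i \<noteq> j \<Longrightarrow> \<not> meets (U i) (U j)"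
  using spread_skew[OF spread node_spaces node_spaces] inj_node_space by (metis injD)

text \<open>Any other node line is skew to the \<open>i\<close>-th one and can be the kernel.
  Nonemptiness makes the minima in \<open>beta\<close> and \<open>gamma\<close> attained.\<close>

lemma repair_matrices_nonempty: "repair_matrices H i \<noteq> {}"
proof -
  have "\<exists>j. j \<noteq> i"
  proof (rule ccontr)
    assume "\<not> ?thesis"
    then have "(UNIV :: 'n set) = {i}" by auto
    then have "CARD('n) = 1" by (metis card_1_singleton_iff One_nat_def)
    with n show False by simp
  qed
  then obtain j where "j \<noteq> i" by blast
  then obtain M where "M \<in> repair_matrices H i"
    using obtain_repair_matrix[OF U_dim2 U_dim2 U_skew] by metis
  then show ?thesis by blast
qed

text \<open>
  A repair matrix with kernel \<open>K\<close> saves one dimension on each node line that meets \<open>K\<close>, and \<open>K\<close>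
  has only \<open>q + 1\<close> points; \<open>K\<close> being itself a node line saves only \<open>2 < q + 1\<close>.
\<close>

lemma repair_bandwidth_ge:
  assumes M: "M \<in> repair_matrices H i"
  shows "2 * (CARD('n) - 1) \<le> repair_bandwidth H i M + (CARD('a) + 1)"
    and "2 * (CARD('n) - 1) = repair_bandwidth H i M + (CARD('a) + 1) \<Longrightarrow>
      \<exists>B \<in> circle_of S ` (dim2 - spread_lines S). B \<subseteq> U ` (UNIV - {i})"
proof -
  define K where "K = {x. M *v x = 0}"
  have K: "K \<in> dim2" unfolding K_def by (rule repair_matrix_kernel[OF M U_dim2])
  define J where "J = {j \<in> UNIV - {i}. meets K (U j)}"
  \<comment> \<open>\<open>c\<close> bounds the rank lost on a node line that meets
    \<open>K\<close>. It is taken as 2 when \<open>K\<close> is a spread line, where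
    \<open>J\<close> has at most one element, and as 1 otherwise.\<close>
  have sum: "2 * (CARD('n) - 1) \<le> repair_bandwidth H i M + c * card J"
    if "\<And>j. j \<in> J \<Longrightarrow> 2 \<le> rank (M ** mat_block H j) + c" for c
  proof -
    have "2 * (CARD('n) - 1) = (\<Sum>j\<in>UNIV - {i}. 2)" by simp
    also have "\<dots> \<le> (\<Sum>j\<in>UNIV - {i}. rank (M ** mat_block H j) + (if j \<in> J then c else 0))"
    proof (rule sum_mono)
      fix j assume "j \<in> UNIV - {i}"
      then show "2 \<le> rank (M ** mat_block H j) + (if j \<in> J then c else 0)"
        using that[of j] rank_repair_block_ge(1)[OF U_dim2, of M j] K by (auto simp: J_def K_def)
    qed
    also have "\<dots> = repair_bandwidth H i M + (\<Sum>j\<in>UNIV - {i}. if j \<in> J then c else 0)"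
      by (simp add: sum.distrib repair_bandwidth_def)
    also have "(\<Sum>j\<in>UNIV - {i}. if j \<in> J then c else 0) = c * card J"
      by (subst sum.inter_filter[symmetric]) (auto simp: J_def)
    finally show ?thesis .
  qed
  have injU: "inj_on U A" for A using inj_node_space inj_on_subset by blast
  have "2 * (CARD('n) - 1) \<le> repair_bandwidth H i M + (CARD('a) + 1) \<and>
    (2 * (CARD('n) - 1) = repair_bandwidth H i M + (CARD('a) + 1) \<longrightarrow>
      (\<exists>B \<in> circle_of S ` (dim2 - spread_lines S). B \<subseteq> U ` (UNIV - {i})))"
  proof (cases "K \<in> spread_lines S")
    case True
    then have "U ` J \<subseteq> {K}"
      using spread_skew[OF spread True node_spaces] by (auto simp: J_def)
    then have "card (U ` J) \<le> 1" using card_mono[of "{K}" "U ` J"] by simp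
    then have "card J \<le> 1" using card_image[OF injU[of J]] by simp
    then have "2 * (CARD('n) - 1) \<le> repair_bandwidth H i M + 2"
      using sum[of 2] by simp
    then show ?thesis using q by simp
  next
    case False
    then have neq: "K \<noteq> U j" for j using node_spaces by metis
    have le: "2 * (CARD('n) - 1) \<le> repair_bandwidth H i M + card J"
      using sum[of 1] rank_repair_block_ge(2)[OF U_dim2, of M] K neq by (fastforce simp: K_def)
    have sub: "U ` J \<subseteq> circle_of S K" using node_spaces by (auto simp: J_def circle_of_def)
    have card: "card (circle_of S K) = CARD('a) + 1" by (rule card_circle_of[OF spread K False])
    have "card (U ` J) \<le> CARD('a) + 1" using card_mono[OF _ sub] card by simp
    then have cardJ: "card J \<le> CARD('a) + 1" using card_image[OF injU[of J]] by simp
    moreover have "circle_of S K \<subseteq> U ` (UNIV - {i})"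
      if "2 * (CARD('n) - 1) = repair_bandwidth H i M + (CARD('a) + 1)"
    proof -
      \<comment> \<open>Equality in the bandwidth leaves no slack: all q + 1 lines of the circle
        must be node lines other than the \<open>i\<close>-th.\<close>
      have "card (U ` J) = card (circle_of S K)"
        using that le cardJ card card_image[OF injU[of J]] by simp
      then have "U ` J = circle_of S K" using card_subset_eq[OF _ sub] by simp
      moreover have "U ` J \<subseteq> U ` (UNIV - {i})" by (auto simp: J_def)
      ultimately show ?thesis by simp
    qed
    ultimately show ?thesis using le K False by auto
  qed
  then show "2 * (CARD('n) - 1) \<le> repair_bandwidth H i M + (CARD('a) + 1)"
    and "2 * (CARD('n) - 1) = repair_bandwidth H i M + (CARD('a) + 1) \<Longrightarrow>
      \<exists>B \<in> circle_of S ` (dim2 - spread_lines S). B \<subseteq> U ` (UNIV - {i})"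
    by blast+
qed

lemma beta_ge: "2 * (CARD('n) - 1) \<le> beta H i + (CARD('a) + 1)"
  using beta_attained[OF repair_matrices_nonempty] repair_bandwidth_ge(1) by metis

lemma beta_eq_imp_circle:
  assumes "2 * (CARD('n) - 1) = beta H i + (CARD('a) + 1)"
  obtains B where "B \<in> circle_of S ` (dim2 - spread_lines S)" "B \<subseteq> U ` (UNIV - {i})"
proof -
  obtain M where "M \<in> repair_matrices H i" "beta H i = repair_bandwidth H i M"
    using beta_attained[OF repair_matrices_nonempty] by blast
  then show thesis using repair_bandwidth_ge(2) assms that by metis
qed

lemma length_bounds_if_beta_eq:
  assumes "\<And>i. 2 * (CARD('n) - 1) = beta H i + (CARD('a) + 1)"
  shows "min (2 * CARD('a) + 2) (3 * CARD('a) - 3) \<le> CARD('n)" "CARD('n) \<le> CARD('a)\<^sup>2 + 1"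
proof -
  interpret inversive_plane "spread_lines S" "circle_of S ` (dim2 - spread_lines S)" "CARD('a)"
    by (rule regular_spread_inversive_plane[OF regular q])
  have card: "card (range U) = CARD('n)" by (rule card_image[OF inj_node_space])
  have "min (2 * CARD('a) + 2) (3 * CARD('a) - 3) \<le> card (range U)"
  proof (rule card_ge_if_no_common_point)
    show "range U \<subseteq> spread_lines S" using node_spaces by blast
    fix x assume "x \<in> range U"
    then obtain i where i: "x = U i" by blast
    obtain B where B: "B \<in> circle_of S ` (dim2 - spread_lines S)" "B \<subseteq> U ` (UNIV - {i})"
      using beta_eq_imp_circle[OF assms] by blast
    then have "x \<notin> B" using i inj_node_space by (auto dest: injD)
    moreover have "B \<subseteq> range U" using B(2) by auto
    ultimately show "\<exists>B\<in>circle_of S ` (dim2 - spread_lines S). B \<subseteq> range U \<and> x \<notin> B"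
      using B(1) by (intro bexI[of _ B] conjI)
  qed simp
  then show "min (2 * CARD('a) + 2) (3 * CARD('a) - 3) \<le> CARD('n)" by (simp only: card)
  have "card (range U) \<le> card (spread_lines S)"
    using node_spaces by (intro card_mono) auto
  then show "CARD('n) \<le> CARD('a)\<^sup>2 + 1" by (simp only: card card_points)
qed

end

subsection \<open>Average and maximum\<close>

lemma avg_eq_lower_bound_iff:
  fixes f :: "'n::finite \<Rightarrow> nat" and t :: real
  assumes "\<And>i. t \<le> real (f i)"
  shows "(\<Sum>i\<in>UNIV. real (f i)) / real CARD('n) = t \<longleftrightarrow> (\<forall>i. real (f i) = t)"
proof -
  have "(\<Sum>i\<in>UNIV. real (f i)) / real CARD('n) = t \<longleftrightarrow> (\<Sum>i\<in>UNIV. real (f i) - t) = 0"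
    by (simp add: sum_subtractf field_simps)
  also have "\<dots> \<longleftrightarrow> (\<forall>i. real (f i) = t)"
    using assms by (subst sum_nonneg_eq_0_iff) auto
  finally show ?thesis .
qed

lemma max_eq_lower_bound_iff:
  fixes f :: "'n::finite \<Rightarrow> nat" and t :: real
  assumes "\<And>i. t \<le> real (f i)"
  shows "real (Max (range f)) = t \<longleftrightarrow> (\<forall>i. real (f i) = t)"
proof
  assume eq: "real (Max (range f)) = t"
  show "\<forall>i. real (f i) = t"
  proof
    fix i
    have "f i \<le> Max (range f)" by simp
    then show "real (f i) = t" using eq assms[of i] by linarith
  qed
next
  assume eq: "\<forall>i. real (f i) = t"
  have "Max (range f) \<in> range f" by (rule Max_in) auto
  then obtain i where "Max (range f) = f i" by blast
  with eq show "real (Max (range f)) = t" by simp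
qed

context spread_code
begin

text \<open>For small n the bound can be negative, so it is a real number here, and the form over
  the naturals moves \<open>CARD('a) + 1\<close> to the other side. Equality passes from gamma to
  beta because \<open>t\<close> \<le> beta \<le> gamma.\<close>

lemma bound_attained_iff:
  fixes t :: real
  assumes t: "t = 2 * (real CARD('n) - 1) - (real CARD('a) + 1)"
  shows "beta_avg H = t \<longleftrightarrow> (\<forall>i. real (beta H i) = t)"
    and "beta_max H = t \<longleftrightarrow> (\<forall>i. real (beta H i) = t)"
    and "gamma_avg H = t \<longleftrightarrow> (\<forall>i. real (gamma H i) = t)"
    and "gamma_max H = t \<longleftrightarrow> (\<forall>i. real (gamma H i) = t)"
    and "real (gamma H i) = t \<Longrightarrow> real (beta H i) = t"
    and "real (beta H i) = t \<longleftrightarrow> 2 * (CARD('n) - 1) = beta H i + (CARD('a) + 1)"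
    and "real (gamma H i) = t \<longleftrightarrow> 2 * (CARD('n) - 1) = gamma H i + (CARD('a) + 1)"
proof -
  have real_iff: "real k = t \<longleftrightarrow> 2 * (CARD('n) - 1) = k + (CARD('a) + 1)" for k
  proof -
    have "2 * (CARD('n) - 1) = k + (CARD('a) + 1) \<longleftrightarrow> 2 * CARD('n) = k + CARD('a) + 3"
      using n by auto
    also have "\<dots> \<longleftrightarrow> real (2 * CARD('n)) = real (k + CARD('a) + 3)"
      by (rule of_nat_eq_iff[symmetric])
    also have "\<dots> \<longleftrightarrow> real k = t" by (auto simp: t)
    finally show ?thesis ..
  qed
  have lo: "t \<le> real (beta H i)" for i
  proof -
    have "2 * CARD('n) \<le> beta H i + CARD('a) + 3" using beta_ge[of i] n by linarith
    then have "real (2 * CARD('n)) \<le> real (beta H i + CARD('a) + 3)" by (rule of_nat_mono)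
    then show ?thesis by (simp add: t)
  qed
  moreover have le: "real (beta H i) \<le> real (gamma H i)" for i
    using beta_le_gamma[OF repair_matrices_nonempty] by simp
  ultimately have lo': "t \<le> real (gamma H i)" for i by (rule order_trans)
  show "beta_avg H = t \<longleftrightarrow> (\<forall>i. real (beta H i) = t)"
    unfolding beta_avg_def using lo by (rule avg_eq_lower_bound_iff)
  show "beta_max H = t \<longleftrightarrow> (\<forall>i. real (beta H i) = t)"
    unfolding beta_max_def using lo by (rule max_eq_lower_bound_iff)
  show "gamma_avg H = t \<longleftrightarrow> (\<forall>i. real (gamma H i) = t)"
    unfolding gamma_avg_def using lo' by (rule avg_eq_lower_bound_iff)
  show "gamma_max H = t \<longleftrightarrow> (\<forall>i. real (gamma H i) = t)"
    unfolding gamma_max_def using lo' by (rule max_eq_lower_bound_iff)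
  show "real (gamma H i) = t \<Longrightarrow> real (beta H i) = t" using lo[of i] le[of i] by simp
  show "real (beta H i) = t \<longleftrightarrow> 2 * (CARD('n) - 1) = beta H i + (CARD('a) + 1)"
    and "real (gamma H i) = t \<longleftrightarrow> 2 * (CARD('n) - 1) = gamma H i + (CARD('a) + 1)"
    by (rule real_iff)+
qed

end

subsection \<open>Constructing codes\<close>

text \<open>The points of \<open>U\<close> on \<open>K\<close> and on \<open>K'\<close> form a basis
  when they differ; when they coincide, that point is extended by any second vector.\<close>

lemma basis_meeting_two:
  assumes U: "U \<in> dim2" and K: "meets K U" "meets K' U" "vec.subspace K'"
  obtains x y where "U = vec.span {x, y}" "x \<in> K \<or> y \<in> K" "x \<in> K' \<or> y \<in> K'"
proof -
  obtain v v' where v: "v \<noteq> 0" "v \<in> K" "v \<in> U" and v': "v' \<noteq> 0" "v' \<in> K'" "v' \<in> U"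
    using K by (auto simp: meets_def)
  show thesis
  proof (cases "v' \<in> vec.span {v}")
    case True
    then obtain k where k: "v' = k *s v" by (auto simp: vec.span_singleton)
    with v' have "k \<noteq> 0" by auto
    then have "v = inverse k *s v'" using k by simp
    then have "v \<in> K'" using v' K(3) by (simp add: vec.subspace_scale)
    moreover obtain y where "U = vec.span {v, y}" using dim2_obtain_basis[OF U v(3,1)] by blast
    ultimately show thesis using that v by blast
  next
    case False
    then show thesis using dim2_eq_span[OF U v(3) v'(3) v(1)] that v v' by blast
  qed
qed

lemma obtain_parity_check_matrix:
  fixes f :: "'n::finite \<Rightarrow> ('a::field ^ 4) set" and c :: "'n \<Rightarrow> 2 \<Rightarrow> 'a ^ 4"
  obtains H :: "'a ^ ('n \<times> 2) ^ 4" where "\<And>i b. column b (mat_block H i) = c i b"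
proof
  show "column b (mat_block (\<chi> a p. c (fst p) (snd p) $ a) i) = c i b" for i b
    by (simp add: column_def mat_block_def vec_eq_iff)
qed

lemma sum_blocks_eq_mult:
  fixes H :: "'a::field ^ ('n::finite \<times> 'l::finite) ^ 'm"
  shows "(\<Sum>i\<in>UNIV. mat_block H i *v word_block c i) = H *v c"
proof -
  have "(\<Sum>i\<in>UNIV. \<Sum>b\<in>UNIV. H $ a $ (i, b) * c $ (i, b)) = (\<Sum>p\<in>UNIV. H $ a $ p * c $ p)" for a
    by (simp add: sum.cartesian_product)
  then show ?thesis
    by (simp add: vec_eq_iff matrix_vector_mult_def mat_block_def word_block_def)
qed

lemma node_space_subset_range:
  fixes H :: "'a::field ^ ('n::finite \<times> 2) ^ 4"
  shows "node_space H i \<subseteq> range ((*v) H)"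
proof -
  have "column b (mat_block H i) = H *v axis (i, b) 1" for b
    by (simp add: column_def mat_block_def vec_eq_iff matrix_vector_mult_def axis_def if_distrib
        cong: if_cong)
  moreover have "vec.subspace (range ((*v) H))" by (intro vec.subspace_image) simp
  ultimately show ?thesis unfolding node_space_2 by (intro vec.span_minimal) auto
qed

text \<open>Two skew node spaces already fill the space of syndromes, so \<open>H\<close> is
  surjective; this yields both the full row rank and the kernel dimension 2n - 4.\<close>

lemma array_code_of_skew_nodes:
  fixes H :: "'a::field ^ ('n::finite \<times> 2) ^ 4"
  assumes n: "CARD('n) \<ge> 3" and U: "\<And>i. node_space H i \<in> dim2"
    and skew: "\<And>i j. i \<noteq> j \<Longrightarrow> \<not> meets (node_space H i) (node_space H j)"
  shows "array_code (CARD('n) - 2) {c. H *v c = 0}" "parity_check_matrix {c. H *v c = 0} H"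
    "mds (CARD('n) - 2) H"
proof -
  show "mds (CARD('n) - 2) H" using mds_iff_skew[of H] n U skew by simp
  obtain T :: "'n set" where "card T = 2"
    using n obtain_subset_with_card_n[of 2 "UNIV :: 'n set"] by auto
  then obtain i j :: 'n where "i \<noteq> j" by (auto simp: card_2_iff)
  have "w \<in> range ((*v) H)" for w
  proof -
    obtain x y where "x \<in> node_space H i" "y \<in> node_space H j" and w: "w = x + y"
      using skew_sum[OF U U skew[OF \<open>i \<noteq> j\<close>], of w] by blast
    then have "x \<in> range ((*v) H)" "y \<in> range ((*v) H)"
      using node_space_subset_range by (meson subsetD)+
    moreover have "vec.subspace (range ((*v) H))" by (intro vec.subspace_image) simp
    ultimately show ?thesis unfolding w by (intro vec.subspace_add)
  qed
  then obtain B where HB: "H ** B = mat 1" using matrix_right_invertible_surjective[of H] by auto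
  have "vec.dim {c. H *v c = 0} = (CARD('n) - 2) * 2"
    using dim_kernel_right_invertible[OF HB] by simp
  then show "array_code (CARD('n) - 2) {c. H *v c = 0}"
    using n kernel_subspace by (auto simp: array_code_def)
  show "parity_check_matrix {c. H *v c = 0} H"
    using rank_right_invertible[OF HB] by (simp add: parity_check_matrix_def sum_blocks_eq_mult)
qed

text \<open>A repair matrix with kernel \<open>K\<close> annihilates a column at each of the q + 1
  nodes on the circle, all of them helpers since node \<open>i\<close> is off it. The matching lower
  bound is inherited from beta.\<close>

lemma (in spread_code) gamma_eq_if_columns_on_transversal:
  assumes K: "K \<in> dim2" "K \<notin> spread_lines S" and sub: "circle_of S K \<subseteq> range U"
    and i: "U i \<notin> circle_of S K"
    and col: "\<And>j. U j \<in> circle_of S K \<Longrightarrow> \<exists>b. column b (mat_block H j) \<in> K"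
  shows "2 * (CARD('n) - 1) = gamma H i + (CARD('a) + 1)"
proof -
  have "\<not> meets K (U i)" using i node_spaces by (auto simp: circle_of_def)
  then obtain M where M: "M \<in> repair_matrices H i" and ker: "{x. M *v x = 0} = K"
    using obtain_repair_matrix[OF U_dim2 K(1)] by metis
  define J where "J = {j \<in> UNIV - {i}. U j \<in> circle_of S K}"
  have "repair_io H i M + card J = (\<Sum>j\<in>UNIV - {i}. nz (M ** mat_block H j) + (if j \<in> J then 1 else 0))"
  proof -
    have "card J = (\<Sum>j\<in>UNIV - {i}. if j \<in> J then 1 else 0)"
      by (subst sum.inter_filter[symmetric]) (auto simp: J_def)
    then show ?thesis by (simp add: repair_io_def sum.distrib)
  qed
  also have "\<dots> \<le> (\<Sum>j\<in>UNIV - {i}. 2)"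
  proof (rule sum_mono)
    fix j
    show "nz (M ** mat_block H j) + (if j \<in> J then 1 else 0) \<le> 2"
    proof (cases "j \<in> J")
      case True
      then obtain b where "column b (mat_block H j) \<in> K" using col by (auto simp: J_def)
      then have "M *v column b (mat_block H j) = 0" using ker by blast
      then show ?thesis using nz_repair_block_le(2)[of M b H j] by simp
    next
      case False
      then show ?thesis using nz_repair_block_le(1)[of M H j] by simp
    qed
  qed
  also have "\<dots> = 2 * (CARD('n) - 1)" by simp
  finally have "repair_io H i M + card J \<le> 2 * (CARD('n) - 1)" .
  moreover have "card J = CARD('a) + 1"
  proof -
    have "U ` J = circle_of S K"
    proof
      show "circle_of S K \<subseteq> U ` J"
      proof
        fix L assume L: "L \<in> circle_of S K"
        then obtain j where j: "L = U j" using sub by blast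
        then have "j \<noteq> i" using L i by auto
        then have "j \<in> J" using L j by (simp add: J_def)
        then show "L \<in> U ` J" using j by blast
      qed
    qed (auto simp: J_def)
    moreover have "card (U ` J) = card J"
      by (rule card_image) (rule inj_on_subset[OF inj_node_space subset_UNIV])
    ultimately show ?thesis using card_circle_of[OF spread K] by simp
  qed
  ultimately have "gamma H i + (CARD('a) + 1) \<le> 2 * (CARD('n) - 1)"
    using gamma_le[OF M] by linarith
  moreover have "2 * (CARD('n) - 1) \<le> gamma H i + (CARD('a) + 1)"
    using beta_ge[of i] beta_le_gamma[OF repair_matrices_nonempty, of i] by linarith
  ultimately show ?thesis by simp
qed

lemma basis_meeting_le_two:
  fixes \<K> :: "('a::field ^ 'm) set set"
  assumes U: "U \<in> dim2" and \<K>: "finite \<K>" "card \<K> \<le> 2"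
    and K: "\<And>K. K \<in> \<K> \<Longrightarrow> meets K U \<and> vec.subspace K"
  shows "\<exists>x y. U = vec.span {x, y} \<and> (\<forall>K\<in>\<K>. x \<in> K \<or> y \<in> K)"
proof -
  \<comment> \<open>Families with fewer than two members are padded with \<open>U\<close>, which
    trivially meets itself.\<close>
  have "\<exists>K K'. \<K> \<subseteq> {K, K'} \<and> {K, K'} \<subseteq> insert U \<K>"
  proof -
    consider "card \<K> = 0" | "card \<K> = 1" | "card \<K> = 2" using \<K>(2) by linarith
    then show ?thesis
    proof cases
      case 1
      then show ?thesis using \<K>(1) by auto
    next
      case 2
      then obtain K where "\<K> = {K}" by (auto simp: card_1_singleton_iff)
      then show ?thesis by auto
    next
      case 3
      then obtain K K' where "\<K> = {K, K'}" by (auto simp: card_2_iff)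
      then show ?thesis by auto
    qed
  qed
  then obtain K K' where KK: "\<K> \<subseteq> {K, K'}" "{K, K'} \<subseteq> insert U \<K>"
    by (elim exE conjE) (rule that)
  have "meets L U \<and> vec.subspace L" if "L \<in> {K, K'}" for L
  proof -
    have "L = U \<or> L \<in> \<K>" using that KK(2) by blast
    then show ?thesis using K dim2_meets_self[OF U] dim2_subspace[OF U] by metis
  qed
  then have "meets K U" "meets K' U" "vec.subspace K'" by auto
  then obtain x y where "U = vec.span {x, y}" "x \<in> K \<or> y \<in> K" "x \<in> K' \<or> y \<in> K'"
    using basis_meeting_two[OF U] by metis
  with KK(1) show ?thesis by blast
qed

lemma optimal_code_exists:
  fixes S :: "('a::{field,finite} ^ 4) set set set"
  assumes S: "regular_spread S" and q: "CARD('a) \<ge> 3"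
    and n: "min (2 * CARD('a) + 2) (3 * CARD('a) - 3) \<le> CARD('n::finite)"
      "CARD('n) \<le> CARD('a)\<^sup>2 + 1"
  shows "\<exists>H :: 'a ^ ('n \<times> 2) ^ 4. spread_code S H \<and>
    (\<forall>i. 2 * (CARD('n) - 1) = gamma H i + (CARD('a) + 1))"
proof -
  interpret inversive_plane "spread_lines S" "circle_of S ` (dim2 - spread_lines S)" "CARD('a)"
    by (rule regular_spread_inversive_plane[OF S q])
  obtain N \<F> where N: "N \<subseteq> spread_lines S" "card N = CARD('n)"
    and \<F>: "\<F> \<subseteq> circle_of S ` (dim2 - spread_lines S)" "\<Union>\<F> \<subseteq> N"
      "\<forall>x. \<exists>B\<in>\<F>. x \<notin> B" "\<forall>x. card {B \<in> \<F>. x \<in> B} \<le> 2"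
    by (rule obtain_points_with_circles[OF n])
  obtain f :: "'n \<Rightarrow> ('a ^ 4) set" where f: "bij_betw f UNIV N"
    using finite_same_card_bij[of "UNIV :: 'n set" N] N finite_subset[OF N(1)] by auto
  have fN: "f i \<in> N" for i using f by (auto simp: bij_betw_def)
  then have f_dim2: "f i \<in> dim2" for i using N(1) spread_lines_dim2 by blast
  \<comment> \<open>One transversal is fixed per circle, not per node: the columns are chosen once,
    and \<open>K B\<close> is the repair kernel for all nodes off \<open>B\<close> that use this
    circle.\<close>
  have "\<forall>B\<in>\<F>. \<exists>K. K \<in> dim2 \<and> K \<notin> spread_lines S \<and> B = circle_of S K" using \<F>(1) by blast
  then obtain K where K: "\<And>B. B \<in> \<F> \<Longrightarrow> K B \<in> dim2 \<and> K B \<notin> spread_lines S \<and> B = circle_of S (K B)"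
    by metis
  have "\<exists>x y. f i = vec.span {x, y} \<and> (\<forall>B\<in>\<F>. f i \<in> B \<longrightarrow> x \<in> K B \<or> y \<in> K B)" for i
  proof -
    let ?\<K> = "K ` {B \<in> \<F>. f i \<in> B}"
    have fin: "finite {B \<in> \<F>. f i \<in> B}"
      by (rule finite_subset[of _ "Pow (spread_lines S)"]) (use \<F>(2) N(1) in auto)
    have "card ?\<K> \<le> 2" using card_image_le[OF fin, of K] \<F>(4)[rule_format, of "f i"] by linarith
    moreover have "meets L (f i) \<and> vec.subspace L" if L: "L \<in> ?\<K>" for L
    proof -
      obtain B where B: "B \<in> \<F>" "f i \<in> B" "L = K B" using L by blast
      then have "f i \<in> circle_of S L" "L \<in> dim2" using K[OF B(1)] by auto
      then show ?thesis by (simp add: circle_of_def dim2_subspace)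
    qed
    ultimately have "\<exists>x y. f i = vec.span {x, y} \<and> (\<forall>L\<in>?\<K>. x \<in> L \<or> y \<in> L)"
      using fin by (intro basis_meeting_le_two[OF f_dim2]) simp_all
    moreover have "(\<forall>L\<in>?\<K>. P L) \<longleftrightarrow> (\<forall>B\<in>\<F>. f i \<in> B \<longrightarrow> P (K B))" for P by blast
    ultimately show ?thesis by (simp only:)
  qed
  then obtain x y where xy: "\<And>i. f i = vec.span {x i, y i}"
    "\<And>i B. \<lbrakk>B \<in> \<F>; f i \<in> B\<rbrakk> \<Longrightarrow> x i \<in> K B \<or> y i \<in> K B" by metis
  obtain H :: "'a ^ ('n \<times> 2) ^ 4"
    where H: "\<And>i b. column b (mat_block H i) = (if b = 1 then x i else y i)"
    using obtain_parity_check_matrix[of "\<lambda>i b. if b = 1 then x i else y i"] by metis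
  have U: "node_space H = f" by (simp add: fun_eq_iff node_space_2 H xy(1))
  have "3 \<le> CARD('n)" using n(1) q by (simp add: min_def split: if_splits)
  then interpret spread_code S H
    using S q fN N(1) f by unfold_locales (auto simp: U bij_betw_def)
  have "2 * (CARD('n) - 1) = gamma H i + (CARD('a) + 1)" for i
  proof -
    obtain B where B: "B \<in> \<F>" "f i \<notin> B" using \<F>(3) by blast
    note KB = K[OF B(1)]
    show ?thesis
    proof (rule gamma_eq_if_columns_on_transversal)
      show "K B \<in> dim2" "K B \<notin> spread_lines S" using KB by auto
      show "circle_of S (K B) \<subseteq> range (node_space H)"
        using KB \<F>(2) B(1) f by (auto simp: U bij_betw_def)
      show "node_space H i \<notin> circle_of S (K B)" using KB B by (simp add: U)
      fix j assume "node_space H j \<in> circle_of S (K B)"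
      then have "f j \<in> B" using KB by (simp add: U)
      then consider "x j \<in> K B" | "y j \<in> K B" using xy(2)[OF B(1)] by blast
      then show "\<exists>b. column b (mat_block H j) \<in> K B"
        using H[of 1 j] H[of 2 j] by cases (auto intro: exI[of _ 1] exI[of _ 2])
    qed
  qed
  with spread_code_axioms show ?thesis by blast
qed

theorem theorem1p4:
  fixes S :: "('a::{field,finite} ^ 4) set set set"
  assumes "CARD('a) \<ge> 3"
    and "regular_spread S"
  shows
    "((min (2 * CARD('a) + 2) (3 * CARD('a) - 3) \<le> CARD('n::finite) \<and>
       CARD('n) \<le> CARD('a)^2 + 1)
      \<longleftrightarrow>
      (\<exists>(C :: ('a ^ ('n \<times> 2)) set) (H :: 'a ^ ('n \<times> 2) ^ 4).
         array_code (CARD('n) - 2) C \<and> parity_check_matrix C H \<and> mds (CARD('n) - 2) H \<and>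
         (\<forall>i. node_line H i \<in> S) \<and>
         (\<exists>x\<in>{beta_avg H, beta_max H, gamma_avg H, gamma_max H}.
            x = 2 * (real CARD('n) - 1) - (real CARD('a) + 1))))
     \<and>
     ((min (2 * CARD('a) + 2) (3 * CARD('a) - 3) \<le> CARD('n) \<and>
       CARD('n) \<le> CARD('a)^2 + 1)
      \<longleftrightarrow>
      (\<exists>(C :: ('a ^ ('n \<times> 2)) set) (H :: 'a ^ ('n \<times> 2) ^ 4).
         array_code (CARD('n) - 2) C \<and> parity_check_matrix C H \<and> mds (CARD('n) - 2) H \<and>
         (\<forall>i. node_line H i \<in> S) \<and>
         (\<forall>x\<in>{beta_avg H, beta_max H, gamma_avg H, gamma_max H}.
            x = 2 * (real CARD('n) - 1) - (real CARD('a) + 1))))"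
  (is "(?len \<longleftrightarrow> ?some) \<and> (?len \<longleftrightarrow> ?all)")
proof -
  let ?t = "2 * (real CARD('n) - 1) - (real CARD('a) + 1)"
  \<comment> \<open>Both equivalences come from one cycle: the length range gives all four
    equalities, these give one of them, and one gives the length range.\<close>
  have len_all: ?all if len: ?len
  proof -
    obtain H :: "'a ^ ('n \<times> 2) ^ 4" where H: "spread_code S H"
      and g: "\<And>i. 2 * (CARD('n) - 1) = gamma H i + (CARD('a) + 1)"
      using optimal_code_exists[OF assms(2,1), where 'n='n] len by metis
    interpret spread_code S H by (rule H)
    note att = bound_attained_iff[OF refl]
    have "\<forall>i. real (gamma H i) = ?t" using g att(7) by simp
    moreover from this have "\<forall>i. real (beta H i) = ?t" using att(5) by simp
    ultimately have "\<forall>x\<in>{beta_avg H, beta_max H, gamma_avg H, gamma_max H}. x = ?t"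
      using att(1-4) by simp
    moreover have "\<forall>i. node_line H i \<in> S"
      using node_spaces by (simp add: node_line_node_space spread_lines_def)
    ultimately show ?all
      using array_code_of_skew_nodes[OF n U_dim2 U_skew]
      by (intro exI[of _ "{c. H *v c = 0}"] exI[of _ H] conjI) simp_all
  qed
  have some_len: ?len if some: ?some
  proof -
    obtain C :: "('a ^ ('n \<times> 2)) set" and H :: "'a ^ ('n \<times> 2) ^ 4"
      where C: "array_code (CARD('n) - 2) C" and mds: "mds (CARD('n) - 2) H"
        and lines: "\<And>i. node_line H i \<in> S"
        and ex: "\<exists>x\<in>{beta_avg H, beta_max H, gamma_avg H, gamma_max H}. x = ?t"
      using some by blast
    \<comment> \<open>The dimension parameter \<open>CARD('n) - 2\<close> is at least 1, which
      excludes truncation of the subtraction.\<close>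
    have n: "3 \<le> CARD('n)" using C by (auto simp: array_code_def)
    then have skew: "i \<noteq> j \<Longrightarrow> node_space H i \<in> dim2 \<and> \<not> meets (node_space H i) (node_space H j)" for i j
      using mds mds_iff_skew[of H] by simp
    have dim2: "node_space H i \<in> dim2" for i
    proof -
      \<comment> \<open>The skewness criterion speaks about pairs of nodes, so a second node is
        needed to obtain the dimension of a single node space.\<close>
      have "\<exists>j. i \<noteq> j"
      proof (rule ccontr)
        assume "\<nexists>j. i \<noteq> j"
        then have "(UNIV :: 'n set) = {i}" by auto
        then have "CARD('n) = card {i}" by (rule arg_cong)
        with n show False by simp
      qed
      then obtain j where "i \<noteq> j" ..
      then show ?thesis using skew[of i j] by simp
    qed
    have inj: "inj (node_space H)"
      using skew dim2_meets_self[OF dim2] by (metis injI)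
    have node_spaces: "node_space H i \<in> spread_lines S" for i
      using lines[of i] dim2[of i] by (simp add: spread_lines_def node_line_node_space)
    interpret spread_code S H
      by (rule spread_code.intro[OF assms(2,1) n node_spaces inj])
    note att = bound_attained_iff[OF refl]
    have "beta_avg H = ?t \<or> beta_max H = ?t \<or> gamma_avg H = ?t \<or> gamma_max H = ?t"
      using ex by (simp only: bex_simps simp_thms)
    then have "(\<forall>i. real (beta H i) = ?t) \<or> (\<forall>i. real (gamma H i) = ?t)"
      unfolding att(1-4) by blast
    then have "\<forall>i. real (beta H i) = ?t" using att(5) by blast
    then show ?len using length_bounds_if_beta_eq att(6) by simp
  qed
  have all_some: ?some if ?all
    using that by (elim ex_forward conj_forward) simp_all
  show ?thesis
  proof (intro conjI[OF iffI iffI])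
    show ?some if ?len by (rule all_some[OF len_all[OF that]])
    show ?len if ?some by (rule some_len[OF that])
    show ?all if ?len by (rule len_all[OF that])
    show ?len if ?all by (rule some_len[OF all_some[OF that]])
  qed
qed

end
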